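(* Consider the ARMA system with binary-valued observations, the standing assumptions, the identification algorithm with step size $\gamma>0$, and the constants $h$, $g(h)$, $M$, $h_1$, $f_M$, $f_m$, $M_1$, $M_2$, $\delta$ described in the context. If $$f_{m}\delta-\frac{f_{M}\sqrt{g(h)}\,M_{2}M}{1-h_1}\,(M_{2}+2M_{1})>0,$$ then the estimate $\hat\theta_k$ produced by the algorithm converges to the true parameter $\theta$ in the mean square sense, i.e., with $e_k=\hat\theta_k-\theta$, $$\lim_{k\to\infty}E\{e_k^{T}e_k\}=0.$$
   Context: **System.** Let $p,q\ge 1$ be integers, $z$ the delay (backward shift) operator, $A(z)=a_1+a_2z+\cdots+a_pz^{p-1}$ with $a_p\ne0$, $B(z)=b_1+b_2z+\cdots+b_qz^{q-1}$ (real coefficients), where $1-zA(z)$ and $B(z)$ have no common roots. The system is, for $k\ge1$, $$y_k=A(z)y_{k-1}+B(z)u_k=\sum_{i=1}^p a_iy_{k-i}+\sum_{j=1}^q b_ju_{k-j+1},\qquad z_k=y_k+d_k,\qquad s_k=I_{\{z_k\le C\}},$$ where $u_k\in\mathbb R$ is the input, $d_k\in\mathbb R$ is the noise, $C\in\mathbb R$ is a fixed threshold, and $s_k$ is the binary observation ($s_k=1$ if $z_k\le C$ and $s_k=0$ otherwise). Values at nonpositive times are fixed initial values. Put $\theta=[a_1,\dots,a_p,b_1,\dots,b_q]^T$ (the unknown true parameter) and $\phi_k=[y_{k-1},\dots,y_{k-p},u_k,\dots,u_{k-q+1}]^T$, so $y_k=\phi_k^T\theta$. **Standing assumptions.** 1.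 A number $h\in(0,1)$ is given, and all roots of $1-a_1z-\cdots-a_pz^p=0$ have modulus greater than $1/h$ (in particular they lie outside the unit circle). 2. Let $\Omega\subset\mathbb R^{p+q}$ be the set of parameter vectors satisfying Assumption 1. The true parameter $\theta$ belongs to a known convex compact set $\Theta\subseteq\Omega$. Put $B=\sup_{v\in\Theta}\|v\|$. 3. $\{d_k\}_{k\ge1}$ is i.i.d. with $E\{d_k\}=0$ and known distribution function $F$, whose density $f(x)=dF(x)/dx$ is continuous and $f(x)\ne0$ for all $x$. 4. The input sequence $\{u_k\}$ is bounded, and there exist a constant $\delta_1>0$ and an integer $m>0$ such that $\frac1m\sum_{i=k}^{k+m-1}U_iU_i^T\ge\delta_1I_{p+q}$ for $k=1,2,\dots$ (in the positive semidefinite order), where $U_i=[u_i,u_{i-1},\dots,u_{i-p-q+1}]^T$ and $I_{p+q}$ is the identity matrix. **Algorithm.** Let $\Pi_\Theta(x)=\arg\min_{\lambda\in\Theta}\|x-\lambda\|$ denote the Euclidean projection onto $\Theta$. With step size $\gamma>0$ and given initial values, for $k\ge1$: $$\hat\theta_k=\Pi_\Theta\Big\{\hat\theta_{k-1}+\frac{\gamma}{k}\varphi_k\big(F(C-\varphi_k^T\hat\theta_{k-1})-s_k\big)\Big\},$$ $$\varphi_k=[\hat y_{k-1},\dots,\hat y_{k-p},u_k,\dots,u_{k-q+1}]^T,\qquad \hat y_{k-1}=\varphi_{k-1}^T\hat\theta_{k-1}.$$ **Constants.** $\|\cdot\|$ is the Euclidean norm (for matrices, the induced norm). - $g(h)=p^2h^2+\big(\tfrac{p(p-1)}{2}h^2\big)^2+\cdots+h^{2p}=\sum_{i=1}^p\binom{p}{i}^2h^{2i}$,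 an upper bound for $\sum_{i=1}^pa_i^2$. - Let $A$ be the $p\times p$ companion matrix with first row $(a_1,\dots,a_p)$, ones on the subdiagonal and zeros elsewhere, and let $\rho(A)$ be its spectral radius. Fix $\epsilon>0$ such that $h_1:=\rho(A)+\epsilon\|A\|<1$, and put $M:=\sqrt p\,(1+2/\epsilon)^{p-1}$; then $\|A^k\|\le Mh_1^k$ for all $k\ge0$. - $M_1,M_2>0$ are constants with $\|\phi_k\|\le M_1$ and $\|\varphi_k\|\le M_2$ for all $k$. - $f_M$ and $f_m$ are the maximum and the minimum of $f$ on $[C-BM_2,C+BM_2]\cup[C-BM_1,C+BM_1]$. - $\delta=c_0\delta_1/N$ with $N=p+m$, where $c_0>0$ is a constant such that $\lambda_{\min}\big(\sum_{i=k}^{k+p+m-1}\phi_i\phi_i^T\big)\ge c_0\,\lambda_{\min}\big(\frac1m\sum_{i=k+p}^{k+p+m-1}U_iU_i^T\big)$ for all $k>0$; consequently $\frac1N\sum_{i=k}^{k+N-1}\phi_i\phi_i^T\ge\delta I_{p+q}$ for all $k>0$. *)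

theory Defs
  imports "HOL-Probability.Probability"
begin

text \<open>Parameters and regressors live in \<open>real^('p + 'q)\<close>, where \<open>p = CARD('p)\<close> and
  \<open>q = CARD('q)\<close>: the summand \<open>'p\<close> carries the coordinates \<open>1, ..., p\<close> and \<open>'q\<close> the coordinates
  \<open>p + 1, ..., p + q\<close>. Time is an integer in the signals, so that initial values at nonpositive
  times are available.\<close>

definition coord :: "'n::finite \<Rightarrow> nat" where
  "coord i = Suc (to_nat_on UNIV i)"

lemma bij_betw_coord: "bij_betw (coord :: 'n::finite \<Rightarrow> nat) UNIV {1..CARD('n)}"
proof -
  have "bij_betw (to_nat_on (UNIV::'n set)) UNIV {..<CARD('n)}"
    by (rule to_nat_on_finite) simp
  moreover have "bij_betw Suc {..<CARD('n)} {1..CARD('n)}"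
    by (rule bij_betw_byWitness[where f' = "\<lambda>k. k - 1"]) auto
  ultimately have "bij_betw (Suc \<circ> to_nat_on (UNIV::'n set)) UNIV {1..CARD('n)}"
    by (rule bij_betw_trans)
  then show ?thesis by (simp add: coord_def[abs_def] comp_def)
qed

definition stack :: "(nat \<Rightarrow> real) \<Rightarrow> (nat \<Rightarrow> real) \<Rightarrow> real^('p::finite + 'q::finite)" where
  "stack v w = (\<chi> i. case i of Inl r \<Rightarrow> v (coord r) | Inr r \<Rightarrow> w (coord r))"

lemma inner_stack:
  "(stack v w :: real^('p::finite + 'q::finite)) \<bullet> stack v' w' =
     (\<Sum>i = 1..CARD('p). v i * v' i) + (\<Sum>j = 1..CARD('q). w j * w' j)"
proof -
  have "(stack v w :: real^('p + 'q)) \<bullet> stack v' w' =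
      (\<Sum>r\<in>(UNIV::'p set). v (coord r) * v' (coord r)) +
      (\<Sum>r\<in>(UNIV::'q set). w (coord r) * w' (coord r))"
    by (simp add: inner_vec_def stack_def UNIV_Plus_UNIV[symmetric] sum.Plus
        del: UNIV_Plus_UNIV)
  also have "(\<Sum>r\<in>(UNIV::'p set). v (coord r) * v' (coord r)) = (\<Sum>i = 1..CARD('p). v i * v' i)"
    by (rule sum.reindex_bij_betw[OF bij_betw_coord])
  also have "(\<Sum>r\<in>(UNIV::'q set). w (coord r) * w' (coord r)) = (\<Sum>j = 1..CARD('q). w j * w' j)"
    by (rule sum.reindex_bij_betw[OF bij_betw_coord])
  finally show ?thesis .
qed

definition regressor :: "(int \<Rightarrow> real) \<Rightarrow> (int \<Rightarrow> real) \<Rightarrow> int \<Rightarrow> real^('p::finite + 'q::finite)" where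
  "regressor y u k = stack (\<lambda>i. y (k - int i)) (\<lambda>j. u (k - int j + 1))"

definition input_vector :: "(int \<Rightarrow> real) \<Rightarrow> int \<Rightarrow> real^('p::finite + 'q::finite)" where
  "input_vector u k = stack (\<lambda>i. u (k - int i + 1)) (\<lambda>j. u (k - int (CARD('p) + j) + 1))"

definition ar_fun :: "nat \<Rightarrow> (nat \<Rightarrow> real) \<Rightarrow> complex \<Rightarrow> complex" where
  "ar_fun p a x = 1 - (\<Sum>i = 1..p. complex_of_real (a i) * x ^ i)"

definition input_fun :: "nat \<Rightarrow> (nat \<Rightarrow> real) \<Rightarrow> complex \<Rightarrow> complex" where
  "input_fun q b x = (\<Sum>j = 1..q. complex_of_real (b j) * x ^ (j - 1))"

definition stable_params :: "real \<Rightarrow> (real^('p::finite + 'q::finite)) set" where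
  "stable_params h =
     {stack a b | a b. \<forall>x. ar_fun CARD('p) a x = 0 \<longrightarrow> cmod x > 1 / h}"

definition outer :: "real^'n \<Rightarrow> real^'n \<Rightarrow> real^'n^'n" where
  "outer v w = (\<chi> i j. v $ i * w $ j)"

definition loewner_le :: "real^'n^'n \<Rightarrow> real^'n^'n \<Rightarrow> bool" where
  "loewner_le A B \<longleftrightarrow> (\<forall>x. 0 \<le> x \<bullet> ((B - A) *v x))"

definition eigenvalues :: "'a::field^'n^'n \<Rightarrow> 'a set" where
  "eigenvalues A = {c. \<exists>v. v \<noteq> 0 \<and> A *v v = c *s v}"

text \<open>In the next two definitions the set of eigenvalues is finite and nonempty (for
  \<open>lambda_min\<close>, provided that the matrix is symmetric), so that \<open>SUP\<close> and \<open>Inf\<close> are a maximum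
  and a minimum.\<close>

definition spectral_radius :: "real^'n^'n \<Rightarrow> real" where
  "spectral_radius A = (SUP c\<in>eigenvalues (\<chi> i j. complex_of_real (A $ i $ j)). cmod c)"

definition lambda_min :: "real^'n^'n \<Rightarrow> real" where
  "lambda_min A = Inf (eigenvalues A)"

definition companion :: "(nat \<Rightarrow> real) \<Rightarrow> real^'p^'p::finite" where
  "companion a = (\<chi> i j. if coord i = 1 then a (coord j)
                         else if coord i = coord j + 1 then 1 else 0)"

definition g_bound :: "nat \<Rightarrow> real \<Rightarrow> real" where
  "g_bound p h = (\<Sum>i = 1..p. (real (p choose i))\<^sup>2 * h ^ (2 * i))"

end

theory Submission
  imports Defs "HOL-Computational_Algebra.Fundamental_Theorem_Algebra"
begin

text \<open>Projection onto \<open>\<Theta>\<close> is nonexpansive and \<open>s\<^sub>k\<close> is, given the past, Bernoulli with parameter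
  \<open>F (C - y\<^sub>k)\<close>, so the expected squared error changes at step \<open>k\<close> by at most \<open>2 \<gamma> / k\<close> times the
  expectation of \<open>(\<phi>h\<^sub>k \<bullet> e) * (F (C - \<phi>h\<^sub>k \<bullet> \<theta>h) - F (C - y\<^sub>k))\<close>, up to \<open>O (1 / k\<^sup>2)\<close>, where \<open>e\<close> is the
  previous error. By the mean value theorem this is at most \<open>- f\<^sub>m (\<phi>\<^sub>k \<bullet> e)\<^sup>2\<close> plus cross terms
  containing \<open>\<phi>h\<^sub>k - \<phi>\<^sub>k\<close>. The output deviations \<open>yh - y\<close> obey the autoregression of the true system,
  driven by \<open>\<phi>h\<^sub>k \<bullet> e\<^sub>k\<close>; as the error moves by only \<open>O (1 / k)\<close> per step, powers of the companion
  matrix sum to the bound \<open>M M\<^sub>2 / (1 - h\<^sub>1) \<parallel>e\<parallel> + o (1)\<close> for these deviations. Since both the true and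
  the estimated autoregressive coefficients have norm at most \<open>sqrt (g h)\<close>, the cross terms are
  dominated by the excitation \<open>f\<^sub>m \<delta> \<parallel>e\<parallel>\<^sup>2\<close> exactly under the convergence condition, and averaging over
  an excitation window gives a Robbins-Monro recursion.

  The powers of the companion matrix are bounded without a triangular form: modulo the characteristic
  polynomial, \<open>z\<^sup>k\<close> has coefficients at most \<open>(k choose j) \<rho>\<^sup>k\<^sup>-\<^sup>j\<close> in the Newton basis at the eigenvalues,
  and \<open>(k choose j) \<rho>\<^sup>k\<^sup>-\<^sup>j (2 \<parallel>A\<parallel>)\<^sup>j\<close> is \<open>(2 / \<epsilon>)\<^sup>j\<close> times a term in
  the binomial expansion of \<open>(\<rho> + \<epsilon> \<parallel>A\<parallel>)\<^sup>k\<close>.\<close>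

section \<open>Recursions with decreasing steps\<close>

text \<open>Once \<open>e\<close> stays below \<open>s\<close>, the sequence is driven geometrically
  towards the fixed point \<open>s / (1 - h)\<close> of the map sending \<open>t\<close> to
  \<open>h * t + s\<close>.\<close>

lemma affine_contraction_tendsto_0:
  fixes x e :: "nat \<Rightarrow> real"
  assumes "0 \<le> h" "h < 1" and nonneg: "\<And>k. 0 \<le> x k"
    and step: "\<And>k. x (Suc k) \<le> h * x k + e k" and e: "e \<longlonglongrightarrow> 0"
  shows "x \<longlonglongrightarrow> 0"
proof (rule LIMSEQ_I)
  fix r :: real assume r: "0 < r"
  \<comment> \<open>This value puts the fixed point at \<open>r / 2\<close>; the other half of
    \<open>r\<close> is left for the decaying initial term.\<close>
  define s where "s = r * (1 - h) / 2"
  have s: "0 < s" "s / (1 - h) = r / 2" using r \<open>h < 1\<close> by (simp_all add: s_def field_simps)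
  obtain K where K: "\<And>k. k \<ge> K \<Longrightarrow> \<bar>e k\<bar> < s"
    using LIMSEQ_D[OF e s(1)] by auto
  have bound: "x (K + n) \<le> h ^ n * x K + s / (1 - h)" for n
  proof (induction n)
    case 0
    have "0 \<le> s / (1 - h)" using s r by linarith
    then show ?case by simp
  next
    case (Suc n)
    have "x (K + Suc n) \<le> h * x (K + n) + s"
      using step[of "K + n"] K[of "K + n"] by simp
    also have "\<dots> \<le> h * (h ^ n * x K + s / (1 - h)) + s"
      using Suc assms by (simp add: mult_left_mono)
    also have "\<dots> = h ^ Suc n * x K + s / (1 - h)"
      using assms by (simp add: field_simps)
    finally show ?case .
  qed
  have "(\<lambda>n. h ^ n * x K) \<longlonglongrightarrow> 0"
    by (rule tendsto_mult_left_zero[OF LIMSEQ_power_zero]) (use assms in auto)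
  from LIMSEQ_D[OF this half_gt_zero[OF r]]
  obtain L where L: "\<And>n. n \<ge> L \<Longrightarrow> \<bar>h ^ n * x K\<bar> < r / 2"
    by (auto simp only: diff_zero real_norm_def)
  show "\<exists>no. \<forall>n\<ge>no. norm (x n - 0) < r"
  proof (intro exI allI impI)
    fix n assume n: "n \<ge> K + L"
    then have "x n \<le> h ^ (n - K) * x K + r / 2" using bound[of "n - K"] s by simp
    also have "\<dots> < r" using L[of "n - K"] n by (smt (verit, best) field_sum_of_halves le_add_diff_inverse add_leD1 nat_add_left_cancel_le)
    finally show "norm (x n - 0) < r" using nonneg[of n] by simp
  qed
qed

text \<open>Subtracting \<open>\<eta> / 2\<close> and taking the positive part absorbs the
  perturbation, because eventually \<open>r k \<le> c * (\<eta> / 2)\<close>. What remains satisfies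
  a homogeneous recursion with factors at most \<open>exp (- c / Suc k)\<close>, whose product tends
  to 0 since the harmonic series diverges.\<close>

lemma robbins_monro_tendsto_0:
  fixes U r :: "nat \<Rightarrow> real"
  assumes c: "0 < c" and nonneg: "\<And>k. 0 \<le> U k"
    and step: "\<And>k. k \<ge> K\<^sub>0 \<Longrightarrow> U (Suc k) \<le> (1 - c / real (Suc k)) * U k + r k / real (Suc k)"
    and r: "r \<longlonglongrightarrow> 0"
  shows "U \<longlonglongrightarrow> 0"
proof (rule LIMSEQ_I)
  fix \<eta> :: real assume \<eta>: "0 < \<eta>"
  have "0 < c * (\<eta> / 2)" using c \<eta> by simp
  from LIMSEQ_D[OF r this] obtain K\<^sub>1 where K\<^sub>1: "\<And>k. k \<ge> K\<^sub>1 \<Longrightarrow> \<bar>r k\<bar> < c * (\<eta> / 2)" by auto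
  \<comment> \<open>Beyond this index the factor \<open>1 - c / Suc k\<close> is nonnegative, so
    inequalities may be multiplied by it.\<close>
  obtain K\<^sub>2 where K\<^sub>2: "c \<le> real K\<^sub>2" using real_arch_simple by blast
  define K where "K = max K\<^sub>0 (max K\<^sub>1 K\<^sub>2)"
  define x where "x k = max 0 (U k - \<eta> / 2)" for k
  have x0: "0 \<le> x k" for k by (simp add: x_def)
  have xstep: "x (Suc k) \<le> exp (- c / real (Suc k)) * x k" if k: "k \<ge> K" for k
  proof -
    have ck: "0 \<le> 1 - c / real (Suc k)" using K\<^sub>2 k by (simp add: K_def field_simps)
    have "r k \<le> c * (\<eta> / 2)" using K\<^sub>1[of k] k by (simp add: K_def abs_less_iff)
    then have "r k / real (Suc k) \<le> c / real (Suc k) * (\<eta> / 2)"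
      using divide_right_mono[of "r k" "c * (\<eta> / 2)" "real (Suc k)"] by (simp add: mult_ac)
    then have "U (Suc k) - \<eta> / 2 \<le> (1 - c / real (Suc k)) * (U k - \<eta> / 2)"
      using step[of k] k by (simp add: K_def algebra_simps del: of_nat_Suc)
    also have "\<dots> \<le> (1 - c / real (Suc k)) * x k"
      by (rule mult_left_mono[OF _ ck]) (simp add: x_def)
    finally have "x (Suc k) \<le> (1 - c / real (Suc k)) * x k"
      using ck x0[of k] by (simp add: x_def del: of_nat_Suc)
    also have "\<dots> \<le> exp (- c / real (Suc k)) * x k"
      using exp_ge_add_one_self[of "- c / real (Suc k)"]
      by (intro mult_right_mono[OF _ x0]) simp
    finally show ?thesis .
  qed
  have xbound: "x (K + n) \<le> exp (- c * (harm (K + n) - harm K)) * x K" for n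
  proof (induction n)
    case 0 then show ?case by simp
  next
    case (Suc n)
    have "x (K + Suc n) \<le> exp (- c / real (Suc (K + n))) * x (K + n)"
      using xstep[of "K + n"] by simp
    also have "\<dots> \<le> exp (- c / real (Suc (K + n))) * (exp (- c * (harm (K + n) - harm K)) * x K)"
      using Suc by (intro mult_left_mono) auto
    also have "\<dots> = exp (- c * (harm (K + Suc n) - harm K)) * x K"
      by (simp add: harm_Suc exp_add[symmetric] algebra_simps divide_inverse del: of_nat_Suc)
    finally show ?case .
  qed
  have "(\<lambda>n. exp (- c * (harm n - harm K)) * x K) \<longlonglongrightarrow> 0"
  proof (rule tendsto_mult_left_zero)
    have "filterlim (\<lambda>n. c * (harm n - harm K) :: real) at_top sequentially"
      by (intro filterlim_tendsto_pos_mult_at_top[OF tendsto_const c]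
          filterlim_at_top_add_at_top filterlim_tendsto_add_at_top[OF tendsto_const harm_at_top, of "- harm K", simplified])
    then show "(\<lambda>n. exp (- c * (harm n - harm K))) \<longlonglongrightarrow> 0"
      by (intro filterlim_compose[OF exp_at_bot]) (simp add: filterlim_uminus_at_bot)
  qed
  from LIMSEQ_D[OF this half_gt_zero[OF \<eta>]]
  obtain L where L: "\<And>n. n \<ge> L \<Longrightarrow> \<bar>exp (- c * (harm n - harm K)) * x K\<bar> < \<eta> / 2"
    by (auto simp only: diff_zero real_norm_def)
  show "\<exists>no. \<forall>n\<ge>no. norm (U n - 0) < \<eta>"
  proof (intro exI allI impI)
    fix n assume n: "n \<ge> K + L"
    have "x n < \<eta> / 2" using xbound[of "n - K"] L[of n] n by auto
    then show "norm (U n - 0) < \<eta>" using nonneg[of n] by (simp add: x_def max_def split: if_splits)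
  qed
qed

text \<open>Averaging \<open>V\<close> over a window of length \<open>N\<close> turns the windowed excitation bound \<open>excite\<close> into
  a decrease at every single step.\<close>

lemma windowed_excitation_tendsto_0:
  fixes V T r r' :: "nat \<Rightarrow> real"
  assumes N: "N > 0" and \<gamma>: "\<gamma> > 0" and \<mu>: "\<mu> \<ge> 0" and gap: "\<beta> < \<mu> * \<delta>"
    and V0: "\<And>k. 0 \<le> V k" and VB: "\<And>k. V k \<le> D" and TB: "\<And>k. \<bar>T k\<bar> \<le> D"
    and descent: "\<And>k. k \<ge> K \<Longrightarrow>
      V (Suc k) \<le> V k - \<gamma> / real (Suc k) * (\<mu> * T (Suc k) - \<beta> * V k - r k)"
    and excite: "\<And>k. k \<ge> K \<Longrightarrow> real N * \<delta> * V k - r' k \<le> (\<Sum>i<N. T (Suc (k + i)))"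
    and slow: "\<And>k. k \<ge> K \<Longrightarrow> \<bar>V (Suc k) - V k\<bar> \<le> c / real (Suc k)"
    and r: "r \<longlonglongrightarrow> 0" and r': "r' \<longlonglongrightarrow> 0"
  shows "V \<longlonglongrightarrow> 0"
proof -
  define \<alpha> where "\<alpha> = \<mu> * \<delta> - \<beta>"
  have \<alpha>: "\<alpha> > 0" using gap by (simp add: \<alpha>_def)
  \<comment> \<open>One step changes this average by the change of \<open>V\<close> over a whole
    window, divided by \<open>N\<close>.\<close>
  define U where "U k = (\<Sum>i<N. V (k + i)) / real N" for k
  define G where "G k = \<mu> * T (Suc k) - \<beta> * V k - r k" for k
  have D: "0 \<le> D" using V0[of 0] VB[of 0] by linarith
  have c: "0 \<le> c"
    using order_trans[OF abs_ge_zero slow[of K]] by (simp add: zero_le_divide_iff del: of_nat_Suc)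
  have "Bseq r" using r by (simp add: convergentI convergent_imp_Bseq)
  then obtain R where R: "\<And>k. \<bar>r k\<bar> \<le> R" by (auto simp: Bseq_def)
  define H where "H = \<mu> * D + \<bar>\<beta>\<bar> * D + R"
  have GB: "\<bar>G k\<bar> \<le> H" for k
  proof -
    have "\<bar>\<mu> * T (Suc k)\<bar> \<le> \<mu> * D" using TB \<mu> by (simp add: abs_mult mult_left_mono)
    moreover have "\<bar>\<beta> * V k\<bar> \<le> \<bar>\<beta>\<bar> * D" using VB V0 by (simp add: abs_mult mult_left_mono)
    ultimately show ?thesis using R[of k] unfolding G_def H_def by linarith
  qed
  have H: "0 \<le> H" using GB[of 0] by linarith
  have drift: "\<bar>V (k + i) - V k\<bar> \<le> real i * (c / real (Suc k))" if "k \<ge> K" for k i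
  proof (induction i)
    case 0 then show ?case by simp
  next
    case (Suc i)
    have "\<bar>V (Suc (k + i)) - V (k + i)\<bar> \<le> c / real (Suc (k + i))" using slow[of "k + i"] that by (simp del: of_nat_Suc)
    also have "\<dots> \<le> c / real (Suc k)" using c by (intro divide_left_mono) auto
    finally show ?case using Suc by (simp add: algebra_simps del: of_nat_Suc) (simp add: algebra_simps add_divide_distrib)
  qed
  \<comment> \<open>The error terms of one step, scaled by \<open>Suc k\<close>: the drift of
    \<open>V\<close> and the variation of the step size inside the window, both of order 1/k, then
    the residuals \<open>r'\<close> and \<open>r\<close>.\<close>
  define w where "w k = (\<gamma> * (\<bar>\<mu> * \<delta>\<bar> + \<bar>\<alpha>\<bar> + \<bar>\<beta>\<bar>) * (real N * c) + \<gamma> * H * real N) / real (Suc k)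
     + \<gamma> * \<mu> * \<bar>r' k\<bar> / real N + \<gamma> / real N * (\<Sum>i<N. \<bar>r (k + i)\<bar>)" for k
  have step: "U (Suc k) \<le> (1 - \<gamma> * \<alpha> / real (Suc k)) * U k + w k / real (Suc k)" if k: "k \<ge> K" for k
  proof -
    have window: "V (k + N) - V k \<le> - (\<gamma> / real (Suc k)) * (\<Sum>i<N. G (k + i)) + \<gamma> * H * real N * real N / real (Suc k) / real (Suc k)"
    proof -
      \<comment> \<open>The step size is frozen at its value at \<open>k\<close>. Inside the window
        this alters it by at most order 1/k^2, and it multiplies the bounded
        \<open>G\<close>.\<close>
      have one: "V (Suc (k + i)) - V (k + i) \<le> - (\<gamma> / real (Suc k)) * G (k + i) + \<gamma> * H * real N / real (Suc k) / real (Suc k)"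
        if i: "i < N" for i
      proof -
        have "1 / real (Suc k) - 1 / real (Suc (k + i)) = real i / (real (Suc k) * real (Suc (k + i)))"
          by (simp add: field_simps)
        also have "\<dots> \<le> real N / (real (Suc k) * real (Suc k))"
          using i by (intro frac_le mult_mono) auto
        finally have a: "1 / real (Suc k) - 1 / real (Suc (k + i)) \<le> real N / real (Suc k) / real (Suc k)" by simp
        have b: "0 \<le> 1 / real (Suc k) - 1 / real (Suc (k + i))"
          by (simp add: frac_le)
        have "(1 / real (Suc k) - 1 / real (Suc (k + i))) * G (k + i) \<le> (real N / real (Suc k) / real (Suc k)) * H"
          using mult_mono[OF a, of "\<bar>G (k + i)\<bar>" H] GB[of "k + i"] b
          by (smt (verit, best) mult_left_mono abs_ge_self abs_ge_zero zero_le_divide_iff of_nat_0_le_iff)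
        then have "\<gamma> * ((1 / real (Suc k) - 1 / real (Suc (k + i))) * G (k + i)) \<le> \<gamma> * ((real N / real (Suc k) / real (Suc k)) * H)"
          using \<gamma> by (intro mult_left_mono) auto
        moreover have "V (Suc (k + i)) - V (k + i) \<le> - (\<gamma> / real (Suc (k + i)) * G (k + i))"
          using descent[of "k + i"] k by (simp add: G_def del: of_nat_Suc)
        ultimately show ?thesis by (simp add: algebra_simps del: of_nat_Suc)
      qed
      have "V (k + N) - V k = (\<Sum>i<N. V (Suc (k + i)) - V (k + i))"
        using sum_lessThan_telescope[of "\<lambda>i. V (k + i)" N] by simp
      also have "\<dots> \<le> (\<Sum>i<N. - (\<gamma> / real (Suc k)) * G (k + i) + \<gamma> * H * real N / real (Suc k) / real (Suc k))"
        by (intro sum_mono one) auto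
      finally show ?thesis
        by (simp only: sum.distrib sum_distrib_left[symmetric] sum_constant card_lessThan) (simp add: mult_ac)
    qed
    have "- (\<gamma> / real (Suc k)) * (\<Sum>i<N. G (k + i)) \<le> - (\<gamma> / real (Suc k)) *
       (real N * \<alpha> * U k - real N * ((\<bar>\<mu> * \<delta>\<bar> + \<bar>\<alpha>\<bar> + \<bar>\<beta>\<bar>) * (real N * c / real (Suc k))) - \<mu> * \<bar>r' k\<bar> - (\<Sum>i<N. \<bar>r (k + i)\<bar>))"
    proof -
      have "\<mu> * (real N * \<delta> * V k - \<bar>r' k\<bar>) \<le> \<mu> * (\<Sum>i<N. T (Suc (k + i)))"
        by (rule mult_left_mono[OF _ \<mu>]) (use excite[OF k] in linarith)
      moreover have "(\<Sum>i<N. r (k + i)) \<le> (\<Sum>i<N. \<bar>r (k + i)\<bar>)" by (intro sum_mono) auto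
      moreover define q where "q = real N * c / real (Suc k)"
      have dr: "\<bar>V (k + i) - V k\<bar> \<le> q" if "i < N" for i
        using drift[OF k, of i] that c mult_right_mono[of "real i" "real N" "c / real (Suc k)"]
        unfolding q_def by simp
      moreover have UV: "\<bar>U k - V k\<bar> \<le> q"
      proof -
        have "U k - V k = (\<Sum>i<N. V (k + i) - V k) / real N"
          using N by (simp add: U_def sum_subtractf field_simps)
        moreover have "\<bar>\<Sum>i<N. V (k + i) - V k\<bar> \<le> real N * q"
          using sum_bounded_above[of "{..<N}" "\<lambda>i. \<bar>V (k + i) - V k\<bar>" q] dr
          by (intro order_trans[OF sum_abs]) auto
        ultimately have "\<bar>U k - V k\<bar> \<le> real N * q / real N"
          by (simp only: abs_divide abs_of_nat divide_right_mono of_nat_0_le_iff)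
        then show ?thesis using N by simp
      qed
      have NU: "real N * U k = (\<Sum>i<N. V (k + i))" using N by (simp add: U_def)
      have "(\<Sum>i<N. G (k + i)) = \<mu> * (\<Sum>i<N. T (Suc (k + i))) - \<beta> * (real N * U k) - (\<Sum>i<N. r (k + i))"
        by (simp only: G_def sum_subtractf sum_distrib_left[symmetric] NU)
      \<comment> \<open>\<open>U k\<close> and \<open>V k\<close> differ by at most
        \<open>q\<close>, so the excitation gain on \<open>V k\<close> can be charged against
        \<open>U k\<close>, leaving the net rate \<open>\<alpha>\<close>.\<close>
      moreover have "real N * (\<mu> * \<delta> * V k - \<beta> * U k) \<ge> real N * (\<alpha> * U k - (\<bar>\<mu> * \<delta>\<bar> + \<bar>\<alpha>\<bar> + \<bar>\<beta>\<bar>) * q)"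
      proof (rule mult_left_mono)
        have "\<bar>\<mu> * \<delta> * (U k - V k)\<bar> \<le> \<bar>\<mu> * \<delta>\<bar> * q"
          unfolding abs_mult using UV by (intro mult_mono) auto
        moreover have "0 \<le> (\<bar>\<alpha>\<bar> + \<bar>\<beta>\<bar>) * q" using UV by simp
        ultimately show "\<alpha> * U k - (\<bar>\<mu> * \<delta>\<bar> + \<bar>\<alpha>\<bar> + \<bar>\<beta>\<bar>) * q \<le> \<mu> * \<delta> * V k - \<beta> * U k"
          by (simp add: \<alpha>_def algebra_simps abs_le_iff)
      qed simp
      ultimately have "real N * \<alpha> * U k - real N * ((\<bar>\<mu> * \<delta>\<bar> + \<bar>\<alpha>\<bar> + \<bar>\<beta>\<bar>) * q) - \<mu> * \<bar>r' k\<bar> - (\<Sum>i<N. \<bar>r (k + i)\<bar>) \<le> (\<Sum>i<N. G (k + i))"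
        by (simp add: algebra_simps)
      then show ?thesis using \<gamma> unfolding q_def
        by (intro mult_left_mono_neg) auto
    qed
    with window have A: "V (k + N) - V k \<le> - (\<gamma> / real (Suc k)) *
       (real N * \<alpha> * U k - real N * ((\<bar>\<mu> * \<delta>\<bar> + \<bar>\<alpha>\<bar> + \<bar>\<beta>\<bar>) * (real N * c / real (Suc k))) - \<mu> * \<bar>r' k\<bar> - (\<Sum>i<N. \<bar>r (k + i)\<bar>))
        + \<gamma> * H * real N * real N / real (Suc k) / real (Suc k)" by linarith
    have "U (Suc k) - U k = (V (k + N) - V k) / real N"
      using N sum_lessThan_telescope[of "\<lambda>i. V (k + i)" N]
      by (simp add: U_def sum_subtractf diff_divide_distrib[symmetric])
    also have "\<dots> \<le> (- (\<gamma> / real (Suc k)) *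
       (real N * \<alpha> * U k - real N * ((\<bar>\<mu> * \<delta>\<bar> + \<bar>\<alpha>\<bar> + \<bar>\<beta>\<bar>) * (real N * c / real (Suc k))) - \<mu> * \<bar>r' k\<bar> - (\<Sum>i<N. \<bar>r (k + i)\<bar>))
        + \<gamma> * H * real N * real N / real (Suc k) / real (Suc k)) / real N"
      using A N by (intro divide_right_mono) auto
    also have "\<dots> = - \<gamma> * \<alpha> / real (Suc k) * U k + w k / real (Suc k)"
    proof -
      \<comment> \<open>With \<open>n'\<close> for the inverse of \<open>N\<close> and
        \<open>x\<close> for the inverse of \<open>Suc k\<close>, the identity becomes polynomial
        and free of division.\<close>
      have rearrange: "(- (\<gamma> * x) * (n * \<alpha> * u - n * (Z * (n * c * x)) - s\<^sub>1 - s\<^sub>2) + \<gamma> * H * n * n * x * x) * n'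
          = - \<gamma> * \<alpha> * x * u + ((\<gamma> * Z * (n * c) + \<gamma> * H * n) * x + \<gamma> * s\<^sub>1 * n' + \<gamma> * n' * s\<^sub>2) * x"
        if "n * n' = 1" for n n' x u Z s\<^sub>1 s\<^sub>2 :: real
      proof -
        have "(- (\<gamma> * x) * (n * \<alpha> * u - n * (Z * (n * c * x)) - s\<^sub>1 - s\<^sub>2) + \<gamma> * H * n * n * x * x) * n'
          = (n * n') * (- \<gamma> * \<alpha> * x * u + \<gamma> * Z * (n * c) * x * x + \<gamma> * H * n * x * x)
            + \<gamma> * s\<^sub>1 * n' * x + \<gamma> * n' * s\<^sub>2 * x"
          by (simp add: algebra_simps)
        then show ?thesis unfolding that by (simp add: algebra_simps)
      qed
      show ?thesis unfolding w_def divide_inverse mult.assoc[of \<gamma> \<mu>]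
        by (rule rearrange) (use N in simp)
    qed
    finally show ?thesis by (simp add: algebra_simps)
  qed
  have w: "w \<longlonglongrightarrow> 0"
  proof -
    have 1: "(\<lambda>k. x / real (Suc k)) \<longlonglongrightarrow> 0" for x :: real
      using LIMSEQ_Suc[OF lim_const_over_n[of x]] by simp
    have 2: "(\<lambda>k. \<gamma> / real N * (\<Sum>i<N. \<bar>r (k + i)\<bar>)) \<longlonglongrightarrow> 0"
      by (intro tendsto_mult_right_zero tendsto_null_sum tendsto_rabs_zero LIMSEQ_ignore_initial_segment r)
    have 3: "(\<lambda>k. \<gamma> * \<mu> * \<bar>r' k\<bar> / real N) \<longlonglongrightarrow> 0"
      by (intro tendsto_divide_zero tendsto_mult_right_zero tendsto_rabs_zero r')
    show ?thesis unfolding w_def using tendsto_add[OF tendsto_add[OF 1 3] 2] by simp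
  qed
  have U: "U \<longlonglongrightarrow> 0"
    by (rule robbins_monro_tendsto_0[of "\<gamma> * \<alpha>" U K w]) (use \<gamma> \<alpha> step w in \<open>auto simp: U_def V0 sum_nonneg\<close>)
  have "V k \<le> real N * U k" for k
    using N member_le_sum[of 0 "{..<N}" "\<lambda>i. V (k + i)"] V0 by (simp add: U_def)
  then show ?thesis
    using tendsto_sandwich[of "\<lambda>_. 0" V sequentially "\<lambda>k. real N * U k" 0] V0
      tendsto_mult_right_zero[OF U, of "real N"] by simp
qed

section \<open>Autoregressive polynomials and companion matrices\<close>

text \<open>The bound is the corresponding coefficient of (z + h)^n, where n is the length of the
  list; Pascal's rule carries this domination through one more linear factor.\<close>

lemma norm_coeff_prod_linear_le:
  fixes ls :: "complex list"
  assumes "\<And>l. l \<in> set ls \<Longrightarrow> cmod l \<le> h"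
  shows "cmod (coeff (\<Prod>l\<leftarrow>ls. [:- l, 1:]) i) \<le> real (length ls choose i) * h ^ (length ls - i)"
  using assms
proof (induction ls arbitrary: i)
  case Nil
  then show ?case by (cases i) auto
next
  case (Cons l ls)
  define q where "q = (\<Prod>l\<leftarrow>ls. [:- l, 1:])"
  have l: "cmod l \<le> h" using Cons.prems by simp
  then have h: "0 \<le> h" using norm_ge_zero[of l] by linarith
  have IH: "cmod (coeff q i) \<le> real (length ls choose i) * h ^ (length ls - i)" for i
    unfolding q_def by (rule Cons.IH) (simp add: Cons.prems)
  have le: "cmod (l * coeff q i) \<le> real (length ls choose i) * h ^ (Suc (length ls) - i)" for i
  proof (cases "i \<le> length ls")
    case True
    have "cmod (l * coeff q i) \<le> h * (real (length ls choose i) * h ^ (length ls - i))"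
      unfolding norm_mult using l h IH[of i] by (intro mult_mono) auto
    then show ?thesis using True by (simp add: Suc_diff_le mult_ac)
  next
    case False
    then show ?thesis using IH[of i] by (simp add: binomial_eq_0)
  qed
  show ?case
  proof (cases i)
    case 0
    then show ?thesis using le[of 0] by (simp add: q_def[symmetric])
  next
    case (Suc j)
    have "cmod (coeff (\<Prod>l\<leftarrow>l # ls. [:- l, 1:]) i) = cmod (coeff q j - l * coeff q i)"
      using Suc by (simp add: q_def[symmetric])
    also have "\<dots> \<le> cmod (coeff q j) + cmod (l * coeff q i)" by (rule norm_triangle_ineq4)
    also have "\<dots> \<le> real (length ls choose j) * h ^ (length ls - j) + real (length ls choose i) * h ^ (Suc (length ls) - i)"
      using IH[of j] le[of i] by simp
    also have "\<dots> = real (length (l # ls) choose i) * h ^ (length (l # ls) - i)"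
      using Suc by (simp add: algebra_simps)
    finally show ?thesis .
  qed
qed

text \<open>The reciprocal of \<open>ar_fun\<close>, that is, the characteristic polynomial of the companion matrix.\<close>

definition ar_poly :: "nat \<Rightarrow> (nat \<Rightarrow> real) \<Rightarrow> complex poly" where
  "ar_poly n a = monom 1 n - (\<Sum>i = 1..n. monom (complex_of_real (a i)) (n - i))"

lemma coeff_ar_poly: "coeff (ar_poly n a) k = (if k = n then 1 else if k < n then - complex_of_real (a (n - k)) else 0)"
proof -
  have "(\<Sum>i = 1..n. coeff (monom (complex_of_real (a i)) (n - i)) k) = (\<Sum>i = 1..n. if i = n - k \<and> k < n then complex_of_real (a i) else 0)"
    by (intro sum.cong) auto
  also have "\<dots> = (if k < n then complex_of_real (a (n - k)) else 0)"
    by (cases "k < n") (auto simp: sum.delta)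
  finally show ?thesis by (auto simp: ar_poly_def coeff_sum)
qed

lemma degree_ar_poly: "degree (ar_poly n a) = n"
proof (rule antisym)
  show "degree (ar_poly n a) \<le> n" by (rule degree_le) (simp add: coeff_ar_poly)
  show "n \<le> degree (ar_poly n a)" by (rule le_degree) (simp add: coeff_ar_poly)
qed

lemma poly_ar_poly:
  assumes "x \<noteq> 0"
  shows "poly (ar_poly n a) x = x ^ n * ar_fun n a (1 / x)"
proof -
  have "(\<Sum>i = 1..n. complex_of_real (a i) * x ^ (n - i)) = x ^ n * (\<Sum>i = 1..n. complex_of_real (a i) * (1 / x) ^ i)"
    unfolding sum_distrib_left
    by (intro sum.cong) (use assms in \<open>auto simp: power_diff power_one_over field_simps\<close>)
  then show ?thesis by (simp add: ar_poly_def ar_fun_def poly_sum poly_monom algebra_simps)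
qed

text \<open>The roots come as a list with multiplicities because the Newton basis used later is
  built from initial segments of that list.\<close>

lemma ar_poly_splits:
  obtains ls where "length ls = n" "ar_poly n a = (\<Prod>l\<leftarrow>ls. [:- l, 1:])"
    "\<And>l. l \<in> set ls \<Longrightarrow> poly (ar_poly n a) l = 0"
proof -
  have "ar_poly n a \<noteq> 0" using coeff_ar_poly[of n a n] by auto
  from alg_closed_imp_factorization[OF this]
  obtain A where A: "size A = degree (ar_poly n a)"
    "ar_poly n a = smult (lead_coeff (ar_poly n a)) (\<Prod>x\<in>#A. [:- x, 1:])"
    by blast
  obtain ls where ls: "mset ls = A" using ex_mset by blast
  have eq: "ar_poly n a = (\<Prod>l\<leftarrow>ls. [:- l, 1:])"
    using A(2) by (simp add: degree_ar_poly coeff_ar_poly ls[symmetric] prod_mset_prod_list[symmetric])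
  show ?thesis
  proof
    show "length ls = n" using A(1) ls by (simp add: degree_ar_poly size_mset[symmetric] del: size_mset)
    show "poly (ar_poly n a) l = 0" if "l \<in> set ls" for l
      using that unfolding eq by (induction ls) auto
  qed (rule eq)
qed

text \<open>The nonzero roots of \<open>ar_poly\<close> are the reciprocals of the roots of
  \<open>ar_fun\<close>, hence of modulus at most \<open>h\<close>. Up to sign \<open>a i\<close> is
  the i-th elementary symmetric function of all roots of \<open>ar_poly\<close>, which gives the
  binomial bound.\<close>

lemma stable_params_sum_squares_le:
  fixes v :: "real^('p::finite + 'q::finite)"
  assumes "v \<in> stable_params h" "0 < h"
  shows "(\<Sum>r\<in>UNIV. (v $ Inl r)\<^sup>2) \<le> g_bound CARD('p) h"
proof -
  obtain a b where v: "v = stack a b" and stable: "\<And>x. ar_fun CARD('p) a x = 0 \<Longrightarrow> cmod x > 1 / h"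
    using assms(1) unfolding stable_params_def by blast
  obtain ls where len: "length ls = CARD('p)" and split: "ar_poly CARD('p) a = (\<Prod>l\<leftarrow>ls. [:- l, 1:])"
    and root: "\<And>l. l \<in> set ls \<Longrightarrow> poly (ar_poly CARD('p) a) l = 0"
    by (rule ar_poly_splits[of "CARD('p)" a]) blast
  have ls: "cmod l \<le> h" if "l \<in> set ls" for l
  \<comment> \<open>The root 0, present when the last autoregressive coefficient vanishes, has no
    reciprocal but meets the bound trivially.\<close>
  proof (cases "l = 0")
    case False
    then have "cmod (1 / l) > 1 / h" using root[OF that] stable by (simp add: poly_ar_poly)
    then show ?thesis using False assms(2) by (simp add: norm_divide field_simps)
  qed (use assms in auto)
  have a: "\<bar>a i\<bar> \<le> real (CARD('p) choose i) * h ^ i" if "i \<in> {1..CARD('p)}" for i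
    using norm_coeff_prod_linear_le[of ls h "CARD('p) - i", OF ls] that
    by (simp add: split[symmetric] len coeff_ar_poly binomial_symmetric[symmetric] split: if_splits)
  have "(\<Sum>r\<in>UNIV. (v $ Inl r)\<^sup>2) = (\<Sum>r\<in>(UNIV :: 'p set). (a (coord r))\<^sup>2)"
    by (simp add: v stack_def)
  also have "\<dots> = (\<Sum>i = 1..CARD('p). (a i)\<^sup>2)"
    by (rule sum.reindex_bij_betw[OF bij_betw_coord])
  also have "\<dots> \<le> (\<Sum>i = 1..CARD('p). (real (CARD('p) choose i) * h ^ i)\<^sup>2)"
    by (intro sum_mono) (use power_mono[OF a abs_ge_zero, of _ 2] in auto)
  also have "\<dots> = g_bound CARD('p) h"
    by (simp add: g_bound_def power_mult_distrib power_mult[symmetric] mult.commute)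
  finally show ?thesis .
qed

section \<open>Powers of a matrix annihilated by a product of linear factors\<close>

lemma norm_vector_scalar_mult: "norm (c *s x) = cmod c * norm (x :: complex^'n)"
  unfolding norm_vec_def by (simp add: norm_mult L2_set_right_distrib)

text \<open>The polynomial with roots \<open>ls\<close>, evaluated at \<open>A\<close> and applied
  to a vector. The head of the list acts first, so lengthening \<open>take j ls\<close> by one entry
  applies one more factor on the outside.\<close>

definition shifted_mult :: "complex^'n^'n \<Rightarrow> complex list \<Rightarrow> complex^'n \<Rightarrow> complex^'n" where
  "shifted_mult A ls = fold (\<lambda>l y. A *v y - l *s y) ls"

text \<open>In terms of coefficients the operator is a polynomial in \<open>A\<close>: it commutes
  with \<open>A\<close>, and its vanishing can be read off from the coefficients of the
  product.\<close>

lemma shifted_mult_eq_sum: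
  fixes A :: "complex^'n^'n"
  shows "shifted_mult A ls x = (\<Sum>i\<le>length ls. coeff (\<Prod>l\<leftarrow>ls. [:- l, 1:]) i *s ((*v) A ^^ i) x)"
proof (induction ls arbitrary: x)
  case Nil
  show ?case by (simp add: shifted_mult_def)
next
  case (Cons l ls)
  define q where "q = (\<Prod>l\<leftarrow>ls. [:- l, 1:])"
  \<comment> \<open>The product has degree at most \<open>length ls\<close>; this zero coefficient
    lets the subtracted sum be extended to the range of the shifted one.\<close>
  have q0: "coeff q (Suc (length ls)) = 0"
    unfolding q_def using degree_prod_list_le[of "map (\<lambda>l. [:- l, 1:]) ls"]
    by (intro coeff_eq_0) (simp add: comp_def sum_list_triv)
  have pow: "((*v) A ^^ i) (A *v x - l *s x) = ((*v) A ^^ Suc i) x - l *s ((*v) A ^^ i) x" for i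
    by (induction i) (auto simp: matrix_vector_mult_diff_distrib vector_scalar_commute)
  have "shifted_mult A (l # ls) x = (\<Sum>i\<le>length ls. coeff q i *s ((*v) A ^^ i) (A *v x - l *s x))"
    using Cons by (simp add: shifted_mult_def q_def)
  also have "\<dots> = (\<Sum>i\<le>length ls. coeff q i *s ((*v) A ^^ Suc i) x) - (\<Sum>i\<le>length ls. (l * coeff q i) *s ((*v) A ^^ i) x)"
    unfolding pow by (simp add: sum_subtractf[symmetric] vec.scale_right_diff_distrib mult.commute)
  also have "(\<Sum>i\<le>length ls. (l * coeff q i) *s ((*v) A ^^ i) x) = (\<Sum>i\<le>Suc (length ls). (l * coeff q i) *s ((*v) A ^^ i) x)"
    using q0 by simp
  also have "(\<Sum>i\<le>length ls. coeff q i *s ((*v) A ^^ Suc i) x)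
      = (\<Sum>i\<le>Suc (length ls). coeff (pCons 0 q) i *s ((*v) A ^^ i) x)"
    unfolding sum.atMost_Suc_shift by simp
  also have "\<dots> - (\<Sum>i\<le>Suc (length ls). (l * coeff q i) *s ((*v) A ^^ i) x)
     = (\<Sum>i\<le>Suc (length ls). coeff ([:- l, 1:] * q) i *s ((*v) A ^^ i) x)"
    by (simp only: sum_subtractf[symmetric] vec.scale_left_diff_distrib[symmetric]) (simp add: algebra_simps)
  finally show ?case by (simp add: q_def)
qed

text \<open>Each factor contributes at most \<open>c\<close> from \<open>A\<close> and
  \<open>c\<close> from its root.\<close>

lemma norm_shifted_mult_le:
  fixes A :: "complex^'n^'n"
  assumes "\<And>x. norm (A *v x) \<le> c * norm x" "\<And>l. l \<in> set ls \<Longrightarrow> cmod l \<le> c" "0 \<le> c"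
  shows "norm (shifted_mult A ls x) \<le> (2 * c) ^ length ls * norm x"
  using assms(2)
proof (induction ls arbitrary: x)
  case Nil then show ?case by (simp add: shifted_mult_def)
next
  case (Cons l ls)
  have "norm (A *v x - l *s x) \<le> norm (A *v x) + norm (l *s x)" by (rule norm_triangle_ineq4)
  also have "\<dots> \<le> c * norm x + c * norm x"
    using assms(1)[of x] Cons.prems[of l] by (intro add_mono) (auto simp: norm_vector_scalar_mult mult_right_mono)
  finally have 1: "norm (A *v x - l *s x) \<le> 2 * c * norm x" by simp
  have "norm (shifted_mult A (l # ls) x) \<le> (2 * c) ^ length ls * norm (A *v x - l *s x)"
    using Cons by (simp add: shifted_mult_def)
  also have "\<dots> \<le> (2 * c) ^ length ls * (2 * c * norm x)"
    using 1 assms(3) by (intro mult_left_mono) auto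
  finally show ?case by (simp add: mult_ac)
qed

text \<open>The expansion of \<open>z ^ k\<close> in the Newton basis \<open>(z - l\<^sub>1) \<cdots> (z - l\<^sub>j)\<close>, read modulo the
  annihilating polynomial \<open>(z - l\<^sub>1) \<cdots> (z - l\<^sub>n)\<close>.\<close>

lemma funpow_mult_newton_expansion:
  fixes A :: "complex^'n^'n"
  assumes annihil: "shifted_mult A ls x = 0" and ls: "\<And>l. l \<in> set ls \<Longrightarrow> cmod l \<le> \<rho>" and "0 \<le> \<rho>"
    and ne: "ls \<noteq> []"
  shows "\<exists>c. (\<forall>j. cmod (c j) \<le> real (k choose j) * \<rho> ^ (k - j)) \<and>
    ((*v) A ^^ k) x = (\<Sum>j<length ls. c j *s shifted_mult A (take j ls) x)"
proof (induction k)
  case 0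
  have "((*v) A ^^ 0) x = (\<Sum>j<length ls. (if j = 0 then 1 else 0) *s shifted_mult A (take j ls) x)"
    using ne by (simp add: if_distrib[of "\<lambda>c. c *s _"] shifted_mult_def sum.delta cong: if_cong)
  then show ?case by (intro exI[of _ "\<lambda>j. if j = 0 then 1 else 0"]) auto
next
  case (Suc k)
  then obtain c where c: "\<And>j. cmod (c j) \<le> real (k choose j) * \<rho> ^ (k - j)"
    and eq: "((*v) A ^^ k) x = (\<Sum>j<length ls. c j *s shifted_mult A (take j ls) x)" by blast
  \<comment> \<open>The default 0 past the end of the list keeps
    \<open>cmod (l j) \<le> \<rho>\<close> for every \<open>j\<close>, as the claim bounds all
    coefficients.\<close>
  define l where "l j = (if j < length ls then ls ! j else 0)" for j
  have l: "cmod (l j) \<le> \<rho>" for j using ls assms by (auto simp: l_def)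
  \<comment> \<open>This recursion follows from \<open>A *v y j = y (Suc j) + l j *s y j\<close>;
    Pascal's rule then reproduces the binomial bound.\<close>
  define c' where "c' j = (case j of 0 \<Rightarrow> 0 | Suc i \<Rightarrow> c i) + l j * c j" for j
  define y where "y j = shifted_mult A (take j ls) x" for j
  have y: "A *v y j = y (Suc j) + l j *s y j" if "j < length ls" for j
    using that by (simp add: y_def l_def take_Suc_conv_app_nth shifted_mult_def)
  obtain n where n: "length ls = Suc n" using ne by (cases ls) auto
  have "((*v) A ^^ Suc k) x = A *v (\<Sum>j<length ls. c j *s y j)"
    using eq by (simp add: y_def)
  also have "\<dots> = (\<Sum>j<length ls. c j *s (A *v y j))"
    by (simp add: vec.linear_sum[OF matrix_vector_mul_linear_gen] vector_scalar_commute)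
  also have "\<dots> = (\<Sum>j<length ls. c j *s y (Suc j)) + (\<Sum>j<length ls. (l j * c j) *s y j)"
    by (simp add: y sum.distrib[symmetric] vec.scale_right_distrib mult_ac)
  also have "(\<Sum>j<length ls. c j *s y (Suc j)) = (\<Sum>j<Suc (length ls). (case j of 0 \<Rightarrow> 0 | Suc i \<Rightarrow> c i) *s y j)"
    unfolding sum.lessThan_Suc_shift by simp
  \<comment> \<open>The top term contains the full product of factors and vanishes by
    \<open>annihil\<close>.\<close>
  also have "\<dots> = (\<Sum>j<length ls. (case j of 0 \<Rightarrow> 0 | Suc i \<Rightarrow> c i) *s y j)"
    using annihil by (simp add: y_def)
  finally have "((*v) A ^^ Suc k) x = (\<Sum>j<length ls. c' j *s y j)"
    by (simp add: c'_def vec.scale_left_distrib sum.distrib)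
  moreover have "cmod (c' j) \<le> real (Suc k choose j) * \<rho> ^ (Suc k - j)" for j
  proof -
    have le: "cmod (l j * c j) \<le> real (k choose j) * \<rho> ^ (Suc k - j)"
    proof (cases "j \<le> k")
      case True
      have "cmod (l j * c j) \<le> \<rho> * (real (k choose j) * \<rho> ^ (k - j))"
        unfolding norm_mult using l c assms(3) by (intro mult_mono) auto
      then show ?thesis using True by (simp add: Suc_diff_le mult_ac)
    next
      case False
      then have "c j = 0" using c[of j] by (simp add: binomial_eq_0)
      then show ?thesis using False by simp
    qed
    show ?thesis
    proof (cases j)
      case 0
      then show ?thesis using le by (simp add: c'_def)
    next
      case (Suc i)
      have "cmod (c' j) \<le> cmod (c i) + cmod (l j * c j)"
        unfolding c'_def Suc by (simp add: norm_triangle_ineq)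
      also have "\<dots> \<le> real (k choose i) * \<rho> ^ (k - i) + real (k choose j) * \<rho> ^ (Suc k - j)"
        using c[of i] le by simp
      finally show ?thesis using Suc by (simp add: algebra_simps)
    qed
  qed
  ultimately show ?case unfolding y_def by blast
qed

lemma norm_funpow_mult_le:
  fixes A :: "complex^'n^'n"
  assumes annihil: "shifted_mult A ls x = 0" and ne: "ls \<noteq> []"
    and ls: "\<And>l. l \<in> set ls \<Longrightarrow> cmod l \<le> \<rho>" and \<rho>: "0 \<le> \<rho>" "\<rho> \<le> c"
    and A: "\<And>x. norm (A *v x) \<le> c * norm x" and \<epsilon>: "0 < \<epsilon>"
  shows "norm (((*v) A ^^ k) x) \<le> (1 + 2 / \<epsilon>) ^ (length ls - 1) * (\<rho> + \<epsilon> * c) ^ k * norm x"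
proof -
  obtain d where d: "\<And>j. cmod (d j) \<le> real (k choose j) * \<rho> ^ (k - j)"
    and eq: "((*v) A ^^ k) x = (\<Sum>j<length ls. d j *s shifted_mult A (take j ls) x)"
    using funpow_mult_newton_expansion[OF annihil ls \<rho>(1) ne] by blast
  have c: "0 \<le> c" using \<rho> by simp
  define E where "E = (1 + 2 / \<epsilon>) ^ (length ls - 1)"
  \<comment> \<open>These are the terms of the binomial expansion of
    \<open>(\<rho> + \<epsilon> * c) ^ k\<close>. Replacing \<open>2 * c\<close> by
    \<open>\<epsilon> * c\<close> costs a factor \<open>2 / \<epsilon>\<close> each time, at most
    \<open>length ls - 1\<close> times.\<close>
  define t where "t j = real (k choose j) * (\<epsilon> * c) ^ j * \<rho> ^ (k - j)" for j
  have t: "0 \<le> t j" for j using \<epsilon> c \<rho> by (simp add: t_def)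
  have E: "0 \<le> E" using \<epsilon> by (simp add: E_def)
  have summand: "norm (d j *s shifted_mult A (take j ls) x) \<le> E * t j * norm x" if j: "j < length ls" for j
  proof -
    have "norm (shifted_mult A (take j ls) x) \<le> (2 * c) ^ j * norm x"
      using norm_shifted_mult_le[OF A, of "take j ls" x] ls \<rho> c j
      by (force dest: in_set_takeD simp: min_def)
    then have "norm (d j *s shifted_mult A (take j ls) x) \<le> (real (k choose j) * \<rho> ^ (k - j)) * ((2 * c) ^ j * norm x)"
      unfolding norm_vector_scalar_mult using d[of j] \<rho> by (intro mult_mono) auto
    also have "\<dots> = (2 / \<epsilon>) ^ j * t j * norm x"
      using \<epsilon> by (simp add: t_def power_mult_distrib power_divide)
    also have "\<dots> \<le> E * t j * norm x"
    proof -
      \<comment> \<open>The base is raised above 1 so that the exponent can then be raised to its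
        largest value.\<close>
      have "(2 / \<epsilon>) ^ j \<le> (1 + 2 / \<epsilon>) ^ j" using \<epsilon> by (intro power_mono) auto
      also have "\<dots> \<le> E" unfolding E_def using j \<epsilon> by (intro power_increasing) auto
      finally show ?thesis using t by (intro mult_right_mono) auto
    qed
    finally show ?thesis .
  qed
  have "norm (((*v) A ^^ k) x) \<le> (\<Sum>j<length ls. E * t j * norm x)"
    unfolding eq by (intro sum_norm_le summand) auto
  also have "\<dots> = E * norm x * (\<Sum>j<length ls. t j)" by (simp add: sum_distrib_left mult_ac)
  also have "(\<Sum>j<length ls. t j) \<le> (\<Sum>j\<le>k. t j)"
  proof -
    have "(\<Sum>j<length ls. t j) = (\<Sum>j\<in>{..<length ls} \<inter> {..k}. t j)"
      by (intro sum.mono_neutral_right) (auto simp: t_def)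
    also have "\<dots> \<le> (\<Sum>j\<le>k. t j)" using t by (intro sum_mono2) auto
    finally show ?thesis .
  qed
  also have "(\<Sum>j\<le>k. t j) = (\<rho> + \<epsilon> * c) ^ k"
    by (simp add: t_def binomial_ring add.commute[of \<rho>])
  finally have "norm (((*v) A ^^ k) x) \<le> E * norm x * (\<rho> + \<epsilon> * c) ^ k"
    using E by (simp add: mult_left_mono)
  then show ?thesis by (simp add: E_def mult_ac)
qed

section \<open>The companion matrix: indices, eigenvalues and annihilating polynomial\<close>

definition coord_inv :: "nat \<Rightarrow> 'n::finite" where
  "coord_inv = inv_into UNIV coord"

lemma coord_le: "1 \<le> coord (i::'n::finite)" "coord i \<le> CARD('n)"
  using bij_betw_apply[OF bij_betw_coord, of i] by auto

lemma coord_inv_coord [simp]: "coord_inv (coord i) = i"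
  unfolding coord_inv_def by (rule bij_betw_inv_into_left[OF bij_betw_coord]) simp

lemma coord_coord_inv [simp]: "1 \<le> k \<Longrightarrow> k \<le> CARD('n) \<Longrightarrow> coord (coord_inv k :: 'n::finite) = k"
  unfolding coord_inv_def by (rule bij_betw_inv_into_right[OF bij_betw_coord]) simp

lemma coord_eq_iff [simp]: "coord i = coord j \<longleftrightarrow> i = (j::'n::finite)"
  by (metis coord_inv_coord)

lemma sum_coord: "(\<Sum>i\<in>(UNIV::'n::finite set). g (coord i)) = (\<Sum>k = 1..CARD('n). g k)"
  by (rule sum.reindex_bij_betw[OF bij_betw_coord])

definition complexify :: "real^'n^'n \<Rightarrow> complex^'n^'n" where
  "complexify A = (\<chi> i j. complex_of_real (A $ i $ j))"

text \<open>A real matrix acts separately on real and imaginary parts, and the squared norms of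
  these parts add up.\<close>

lemma norm_complexify_mult_le:
  fixes x :: "complex^'n"
  shows "norm (complexify A *v x) \<le> onorm ((*v) A) * norm x"
proof -
  define re im where "re y = (\<chi> i. Re (y $ i))" and "im y = (\<chi> i. Im (y $ i))" for y :: "complex^'n"
  have norm_sq: "(norm y)\<^sup>2 = (norm (re y))\<^sup>2 + (norm (im y))\<^sup>2" for y
    by (simp add: norm_vec_def L2_set_def re_def im_def sum_nonneg sum.distrib[symmetric] cmod_power2)
  have A: "norm (A *v y) \<le> onorm ((*v) A) * norm y" for y
    by (rule onorm[OF matrix_vector_mul_bounded_linear])
  have "re (complexify A *v x) = A *v re x" "im (complexify A *v x) = A *v im x"
    by (simp_all add: vec_eq_iff re_def im_def complexify_def matrix_vector_mult_def)
  then have "(norm (complexify A *v x))\<^sup>2 = (norm (A *v re x))\<^sup>2 + (norm (A *v im x))\<^sup>2"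
    by (simp add: norm_sq)
  also have "\<dots> \<le> (onorm ((*v) A) * norm (re x))\<^sup>2 + (onorm ((*v) A) * norm (im x))\<^sup>2"
    by (intro add_mono power_mono A) auto
  also have "\<dots> = (onorm ((*v) A) * norm x)\<^sup>2"
    by (simp add: power_mult_distrib norm_sq[of x] distrib_left)
  finally show ?thesis
    by (rule power2_le_imp_le) (simp add: onorm_pos_le[OF matrix_vector_mul_bounded_linear])
qed

text \<open>It makes the set under the supremum in \<open>spectral_radius\<close> bounded and yields
  that the spectral radius is at most the operator norm.\<close>

lemma norm_eigenvalue_complexify_le:
  assumes "c \<in> eigenvalues (complexify A)"
  shows "cmod c \<le> onorm ((*v) A)"
proof -
  obtain v where v: "v \<noteq> 0" "complexify A *v v = c *s v" using assms by (auto simp: eigenvalues_def)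
  have "cmod c * norm v \<le> onorm ((*v) A) * norm v"
    using norm_complexify_mult_le[of A v] by (simp add: v norm_vector_scalar_mult)
  then show ?thesis using v by simp
qed

lemma companion_mult:
  fixes x :: "complex^'p::finite"
  shows "(complexify (companion a) *v x) $ r =
    (if coord r = 1 then (\<Sum>i = 1..CARD('p). complex_of_real (a i) * x $ coord_inv i)
     else x $ coord_inv (coord r - 1))"
proof (cases "coord r = 1")
  case True
  then have "(complexify (companion a) *v x) $ r = (\<Sum>j\<in>(UNIV::'p set). complex_of_real (a (coord j)) * x $ coord_inv (coord j))"
    by (simp add: matrix_vector_mult_def complexify_def companion_def)
  then show ?thesis
    using True by (simp add: sum_coord[of "\<lambda>i. complex_of_real (a i) * x $ coord_inv i"] del: coord_inv_coord)
next
  case False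
  define s where "s = (coord_inv (coord r - 1) :: 'p)"
  have s: "coord s = coord r - 1" using False coord_le[of r] by (simp add: s_def)
  have "(complexify (companion a) *v x) $ r = (\<Sum>j\<in>UNIV. if j = s then x $ j else 0)"
    unfolding matrix_vector_mult_def complexify_def companion_def vec_lambda_beta
  proof (intro sum.cong refl)
    fix j
    have "coord r = coord j + 1 \<longleftrightarrow> j = s"
      using s False coord_le[of r] coord_eq_iff[of j s] by linarith
    then show "complex_of_real (if coord r = 1 then a (coord j) else if coord r = coord j + 1 then 1 else 0) * x $ j =
      (if j = s then x $ j else 0)" using False by simp
  qed
  then show ?thesis using False by (simp add: s_def)
qed

lemma root_ar_poly_eigenvalue:
  assumes "poly (ar_poly CARD('p) a) l = 0"
  shows "l \<in> eigenvalues (complexify (companion a :: real^'p^'p::finite))"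
proof -
  define n where "n = CARD('p)"
  have n: "0 < n" by (simp add: n_def)
  \<comment> \<open>The eigenvector with entries l^(n-1), ..., l, 1; its last entry is 1 even when
    \<open>l = 0\<close>.\<close>
  define v :: "complex^'p" where "v = (\<chi> r. l ^ (n - coord r))"
  have "v $ coord_inv n = 1" using n by (simp add: v_def n_def Suc_le_eq)
  then have "v \<noteq> 0" by auto
  moreover have "complexify (companion a) *v v = l *s v"
    unfolding vec_eq_iff
  proof
    fix r :: 'p
    have r: "1 \<le> coord r" "coord r \<le> n" using coord_le[of r] by (auto simp: n_def)
    have "l ^ n = (\<Sum>i = 1..n. complex_of_real (a i) * l ^ (n - i))"
      using assms by (simp add: ar_poly_def poly_sum poly_monom n_def)
    also have "\<dots> = (\<Sum>i = 1..n. complex_of_real (a i) * v $ coord_inv i)"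
      by (intro sum.cong) (auto simp: v_def n_def)
    finally have "(\<Sum>i = 1..n. complex_of_real (a i) * v $ coord_inv i) = l * l ^ (n - 1)"
      using n by (cases n) auto
    then show "(complexify (companion a) *v v) $ r = (l *s v) $ r"
      unfolding companion_mult n_def[symmetric] using r
      by (auto simp: v_def n_def power_Suc[symmetric] Suc_diff_le simp del: power_Suc)
  qed
  ultimately show ?thesis by (auto simp: eigenvalues_def)
qed

text \<open>Cayley-Hamilton for the companion matrix. The last coordinates of \<open>z\<close>,
  \<open>L z\<close>, ..., \<open>(L ^^ n) z\<close> are linked by the recurrence with coefficients
  \<open>a\<close>, so the last coordinate of \<open>S z\<close> vanishes for every
  \<open>z\<close>. As \<open>S\<close> commutes with \<open>L\<close> and powers of
  \<open>L\<close> shift any coordinate into the last place, all coordinates vanish.\<close>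

lemma companion_shifted_mult_eq_0:
  fixes x :: "complex^'p::finite"
  assumes len: "length ls = CARD('p)" and split: "ar_poly CARD('p) a = (\<Prod>l\<leftarrow>ls. [:- l, 1:])"
  shows "shifted_mult (complexify (companion a)) ls x = 0"
proof -
  define n where "n = CARD('p)"
  define L :: "complex^'p \<Rightarrow> complex^'p" where "L = (*v) (complexify (companion a))"
  define S where "S z = shifted_mult (complexify (companion a)) ls z" for z :: "complex^'p"
  have n: "1 \<le> n" by (simp add: n_def Suc_le_eq)
  have L_low: "(L ^^ m) z $ r = z $ coord_inv (coord r - m)" if "m < coord r" for m z r
    using that
  proof (induction m arbitrary: z)
    case 0 then show ?case by simp
  next
    case (Suc m)
    have "(L ^^ Suc m) z $ r = L z $ coord_inv (coord r - m)"
      using Suc by (simp add: funpow_swap1)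
    also have "\<dots> = z $ coord_inv (coord r - Suc m)"
      using Suc.prems coord_le[of r] by (simp add: L_def companion_mult)
    finally show ?case .
  qed
  have last: "S z $ coord_inv n = 0" for z :: "complex^'p"
  proof -
    have 1: "(L ^^ i) z $ coord_inv n = (z :: complex^'p) $ coord_inv (n - i)" if "i < n" for i
      using L_low[of i "coord_inv n" z] that n by (simp add: n_def)
    have "(L ^^ n) z $ coord_inv n = (L ^^ (n - 1)) (L z) $ coord_inv n"
      using n by (cases n) (auto simp: funpow_swap1)
    also have "\<dots> = L z $ coord_inv 1"
      using L_low[of "n - 1" "coord_inv n" "L z"] n by (simp add: n_def)
    also have "\<dots> = (\<Sum>i = 1..n. complex_of_real (a i) * z $ coord_inv i)"
      using n by (simp add: L_def companion_mult n_def)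
    finally have 2: "(L ^^ n) z $ coord_inv n = (\<Sum>i = 1..n. complex_of_real (a i) * z $ coord_inv i)" .
    have "S z $ coord_inv n = (\<Sum>i\<le>n. coeff (ar_poly n a) i * (L ^^ i) z $ coord_inv n)"
      unfolding S_def shifted_mult_eq_sum split[symmetric] len L_def n_def by simp
    also have "{..n} = insert n {..<n}" by auto
    also have "(\<Sum>i\<in>insert n {..<n}. coeff (ar_poly n a) i * (L ^^ i) z $ coord_inv n)
      = (L ^^ n) z $ coord_inv n + (\<Sum>i<n. - complex_of_real (a (n - i)) * z $ coord_inv (n - i))"
      by (simp add: coeff_ar_poly 1)
    also have "(\<Sum>i<n. - complex_of_real (a (n - i)) * z $ coord_inv (n - i))
      = (\<Sum>i = 1..n. - complex_of_real (a i) * z $ coord_inv i)"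
      by (rule sum.reindex_bij_witness[of _ "\<lambda>i. n - i" "\<lambda>i. n - i"]) auto
    finally show ?thesis by (simp add: 2 sum_negf)
  qed
  have comm: "S (L z) = L (S z)" for z
    by (simp add: S_def L_def shifted_mult_eq_sum vec.linear_sum[OF matrix_vector_mul_linear_gen]
        vector_scalar_commute funpow_swap1)
  then have comm_pow: "S ((L ^^ m) z) = (L ^^ m) (S z)" for m z
    by (induction m) auto
  have "S x $ r = 0" for r
  proof -
    have r: "1 \<le> coord r" "coord r \<le> n" using coord_le[of r] by (auto simp: n_def)
    have "S x $ r = (L ^^ (n - coord r)) (S x) $ coord_inv n"
      using L_low[of "n - coord r" "coord_inv n" "S x"] r n by (simp add: n_def)
    then show ?thesis by (simp add: comm_pow[symmetric] last)
  qed
  then show ?thesis by (simp add: vec_eq_iff S_def)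
qed

text \<open>Embedding real vectors into complex ones preserves the norm and intertwines
  \<open>A\<close> with its complexification, so the bound for annihilated complex matrices applies,
  with the roots of \<open>ar_poly\<close> as eigenvalues.\<close>

lemma norm_funpow_companion_le:
  fixes a :: "nat \<Rightarrow> real" and x :: "real^'p::finite"
  defines "A \<equiv> companion a"
  assumes \<epsilon>: "0 < \<epsilon>"
  shows "norm (((*v) A ^^ k) x) \<le>
    (1 + 2 / \<epsilon>) ^ (CARD('p) - 1) * (spectral_radius A + \<epsilon> * onorm ((*v) A)) ^ k * norm x"
    and "0 \<le> spectral_radius A"
proof -
  define cvec :: "real^'p \<Rightarrow> complex^'p" where "cvec v = (\<chi> i. complex_of_real (v $ i))" for v
  define c where "c = onorm ((*v) A)"
  have norm_cvec: "norm (cvec v) = norm v" for v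
    by (simp add: cvec_def norm_vec_def)
  have mult: "complexify A *v cvec v = cvec (A *v v)" for v
    by (simp add: vec_eq_iff cvec_def complexify_def matrix_vector_mult_def)
  have funpow: "((*v) (complexify A) ^^ k) (cvec v) = cvec (((*v) A ^^ k) v)" for k v
    by (induction k) (simp_all add: mult)
  obtain ls where len: "length ls = CARD('p)" and split: "ar_poly CARD('p) a = (\<Prod>l\<leftarrow>ls. [:- l, 1:])"
    and root: "\<And>l. l \<in> set ls \<Longrightarrow> poly (ar_poly CARD('p) a) l = 0"
    by (rule ar_poly_splits[of "CARD('p)" a]) blast
  have eig: "l \<in> eigenvalues (complexify A)" if "l \<in> set ls" for l
    unfolding A_def by (rule root_ar_poly_eigenvalue[OF root[OF that]])
  have bdd: "bdd_above (cmod ` eigenvalues (complexify A))"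
    by (rule bdd_aboveI2[where M = c]) (simp add: c_def norm_eigenvalue_complexify_le)
  have sr: "spectral_radius A = (SUP c\<in>eigenvalues (complexify A). cmod c)"
    by (simp add: spectral_radius_def complexify_def)
  have le: "cmod l \<le> spectral_radius A" if "l \<in> set ls" for l
    unfolding sr by (rule cSUP_upper[OF eig[OF that] bdd])
  have ne: "ls \<noteq> []" using len by auto
  then have hd: "hd ls \<in> set ls" by simp
  show nonneg: "0 \<le> spectral_radius A" using le[OF hd] norm_ge_zero order_trans by blast
  have "spectral_radius A \<le> c" unfolding sr
    by (rule cSUP_least) (use eig[OF hd] in \<open>auto simp: c_def norm_eigenvalue_complexify_le\<close>)
  then have "norm (((*v) (complexify A) ^^ k) (cvec x)) \<le>
    (1 + 2 / \<epsilon>) ^ (length ls - 1) * (spectral_radius A + \<epsilon> * c) ^ k * norm (cvec x)"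
    by (intro norm_funpow_mult_le[OF _ ne le nonneg _ _ \<epsilon>])
      (auto simp: companion_shifted_mult_eq_0[OF len split] c_def norm_complexify_mult_le A_def)
  then show "norm (((*v) A ^^ k) x) \<le>
    (1 + 2 / \<epsilon>) ^ (CARD('p) - 1) * (spectral_radius A + \<epsilon> * onorm ((*v) A)) ^ k * norm x"
    by (simp add: funpow norm_cvec len c_def)
qed

section \<open>Smallest eigenvalues of symmetric matrices\<close>

text \<open>By compactness the quadratic form attains a minimum \<open>\<mu>\<close> on the unit
  sphere. The minimiser is an eigenvector, since otherwise moving against its residual
  \<open>g\<close> would push the Rayleigh quotient below \<open>\<mu>\<close>; and each eigenvalue
  is a value of that quotient.\<close>

lemma symmetric_min_eigenvalue:
  fixes A :: "real^'n^'n"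
  assumes sym: "transpose A = A"
  obtains \<mu> where "\<mu> \<in> eigenvalues A" "\<And>x. \<mu> * (x \<bullet> x) \<le> x \<bullet> (A *v x)" "lambda_min A = \<mu>"
proof -
  let ?Q = "\<lambda>x. x \<bullet> (A *v x)"
  have "compact (sphere (0::real^'n) 1)" by (rule compact_sphere)
  moreover have "sphere (0::real^'n) 1 \<noteq> {}" by simp
  moreover have "continuous_on (sphere 0 1) ?Q"
    by (intro continuous_intros linear_continuous_on[OF matrix_vector_mul_bounded_linear])
  ultimately obtain v where v: "norm v = 1" and min: "\<And>y. norm y = 1 \<Longrightarrow> ?Q v \<le> ?Q y"
    using continuous_attains_inf[of "sphere 0 1" ?Q] by auto
  define \<mu> where "\<mu> = ?Q v"
  have ray: "\<mu> * (x \<bullet> x) \<le> ?Q x" for x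
  proof (cases "x = 0")
    case False
    have "\<mu> \<le> ?Q (x /\<^sub>R norm x)" unfolding \<mu>_def by (rule min) (use False in simp)
    also have "\<dots> = ?Q x / (norm x)\<^sup>2"
      by (simp add: matrix_vector_mult_scaleR power2_eq_square divide_inverse)
    finally show ?thesis using False by (simp add: field_simps power2_norm_eq_inner)
  qed simp
  have symQ: "x \<bullet> (A *v y) = y \<bullet> (A *v x)" for x y
    using dot_lmul_matrix[of x A y] vector_transpose_matrix[of x A] sym by (simp add: inner_commute)
  have vv: "v \<bullet> v = 1" using v by (simp add: power2_norm_eq_inner[symmetric])
  define g where "g = A *v v - \<mu> *\<^sub>R v"
  have "g = 0"
  proof (rule ccontr)
    assume "g \<noteq> 0"
    define s where "s = g \<bullet> g"
    define c where "c = ?Q g - \<mu> * (g \<bullet> g)"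
    have s: "0 < s" using \<open>g \<noteq> 0\<close> by (simp add: s_def)
    have c: "0 \<le> c" using ray[of g] by (simp add: c_def)
    \<comment> \<open>The gap \<open>?Q x - \<mu> * (x \<bullet> x)\<close> along \<open>x = v - t *\<^sub>R g\<close>.\<close>
    have "0 \<le> - 2 * t * s + t\<^sup>2 * c" for t
    proof -
      have Q: "?Q (v - t *\<^sub>R g) = ?Q v - 2 * t * (g \<bullet> (A *v v)) + t\<^sup>2 * ?Q g"
        by (simp add: matrix_vector_mult_diff_distrib matrix_vector_mult_scaleR inner_diff_left inner_diff_right
            symQ[of v g] power2_eq_square algebra_simps)
      have norm_sq: "(v - t *\<^sub>R g) \<bullet> (v - t *\<^sub>R g) = 1 - 2 * t * (g \<bullet> v) + t\<^sup>2 * (g \<bullet> g)"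
        by (simp add: inner_diff_left inner_diff_right vv inner_commute[of v g] power2_eq_square algebra_simps)
      have gAv: "g \<bullet> (A *v v) = s + \<mu> * (g \<bullet> v)"
        by (simp add: s_def g_def inner_diff_right)
      show ?thesis
        using ray[of "v - t *\<^sub>R g"] unfolding Q norm_sq gAv \<mu>_def[symmetric]
        by (simp add: c_def algebra_simps)
    qed
    \<comment> \<open>A step this small keeps the quadratic term below the linear one;
      \<open>c + 1\<close> replaces \<open>c\<close>, which may be 0.\<close>
    from this[of "s / (c + 1)"] have "0 \<le> (s / (c + 1)) * (- 2 * s + s / (c + 1) * c)"
      by (simp add: power2_eq_square algebra_simps)
    moreover have "0 < s / (c + 1)" using s c by simp
    ultimately have "0 \<le> - 2 * s + s / (c + 1) * c"
      unfolding zero_le_mult_iff by linarith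
    moreover have "s / (c + 1) * c \<le> s" using s c by (simp add: field_simps)
    ultimately show False using s by linarith
  qed
  then have eig: "\<mu> \<in> eigenvalues A"
    unfolding eigenvalues_def using v by (auto intro!: exI[of _ v] simp: g_def scalar_mult_eq_scaleR)
  have lower: "\<mu> \<le> c" if c: "c \<in> eigenvalues A" for c
  proof -
    obtain w where w: "w \<noteq> 0" "A *v w = c *s w" using c by (auto simp: eigenvalues_def)
    then show ?thesis using ray[of w] by (simp add: scalar_mult_eq_scaleR)
  qed
  have "lambda_min A = \<mu>"
    unfolding lambda_min_def by (rule cInf_eq_minimum[OF eig lower])
  then show ?thesis using eig ray by (intro that)
qed

lemma lambda_min_le_inner:
  fixes A :: "real^'n^'n"
  assumes "transpose A = A"
  shows "lambda_min A * (x \<bullet> x) \<le> x \<bullet> (A *v x)"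
  by (rule symmetric_min_eigenvalue[OF assms]) simp

lemma le_lambda_min:
  fixes A :: "real^'n^'n"
  assumes sym: "transpose A = A" and "loewner_le (c *\<^sub>R mat 1) A"
  shows "c \<le> lambda_min A"
proof -
  obtain \<mu> where \<mu>: "\<mu> \<in> eigenvalues A" "lambda_min A = \<mu>"
    by (rule symmetric_min_eigenvalue[OF sym]) blast
  then obtain w where w: "w \<noteq> 0" "A *v w = \<mu> *s w" by (auto simp: eigenvalues_def)
  have "0 \<le> w \<bullet> ((A - c *\<^sub>R mat 1) *v w)" using assms(2) by (simp add: loewner_le_def)
  also have "\<dots> = (\<mu> - c) * (w \<bullet> w)"
    using w by (simp add: matrix_vector_mult_diff_rdistrib scaleR_matrix_vector_assoc[symmetric]
        scalar_mult_eq_scaleR inner_diff_right algebra_simps)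
  finally show ?thesis using w \<mu> by (simp add: zero_le_mult_iff not_le[symmetric] inner_gt_zero_iff[symmetric] del: inner_gt_zero_iff)
qed

section \<open>Sums of outer products as sums of squares\<close>

lemma outer_mult: "outer v w *v x = (w \<bullet> x) *\<^sub>R v"
  by (simp add: vec_eq_iff outer_def matrix_vector_mult_def inner_vec_def sum_distrib_left sum_distrib_right mult_ac)

lemma transpose_sum_outer: "transpose (\<Sum>i\<in>I. outer (v i) (v i)) = (\<Sum>i\<in>I. outer (v i) (v i))"
  by (simp add: vec_eq_iff transpose_def outer_def sum_component mult.commute)

lemma inner_sum_outer: "x \<bullet> ((\<Sum>i\<in>I. outer (v i) (v i)) *v x) = (\<Sum>i\<in>I. (v i \<bullet> x)\<^sup>2)"
proof (induction I rule: infinite_finite_induct)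
  case (insert i I)
  then show ?case
    by (simp add: matrix_vector_mult_add_rdistrib inner_add_right outer_mult power2_eq_square inner_commute)
qed simp_all

section \<open>The error along a single path\<close>

text \<open>The state vector of an autoregression, newest value first: \<open>x k\<close>, ...,
  \<open>x (k - p + 1)\<close>.\<close>

definition window :: "(int \<Rightarrow> real) \<Rightarrow> int \<Rightarrow> real^'p::finite" where
  "window x k = (\<chi> r. x (k + 1 - int (coord r)))"

lemma window_Suc:
  fixes x :: "int \<Rightarrow> real"
  assumes "x (k + 1) = (\<Sum>i = 1..CARD('p). a i * x (k + 1 - int i)) + v"
  shows "window x (k + 1) = companion a *v window x k + v *\<^sub>R (axis (coord_inv 1) 1 :: real^'p::finite)"
proof -
  have "x (k + 1 + 1 - int (coord r)) = (companion a *v window x k) $ r + (if r = coord_inv 1 then v else 0)" for r :: 'p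
  proof (cases "coord r = 1")
    case True
    then have "r = coord_inv 1" by (metis coord_inv_coord)
    moreover have "(companion a *v window x k) $ r = (\<Sum>j\<in>(UNIV::'p set). a (coord j) * x (k + 1 - int (coord j)))"
      using True by (simp add: matrix_vector_mult_def companion_def window_def)
    moreover have "\<dots> = (\<Sum>i = 1..CARD('p). a i * x (k + 1 - int i))"
      by (rule sum_coord)
    moreover have "k + 1 + 1 - int (coord r) = k + 1" using True by simp
    ultimately show ?thesis using assms by (simp only: refl if_True)
  next
    case False
    define s where "s = (coord_inv (coord r - 1) :: 'p)"
    have s: "coord s = coord r - 1" using False coord_le[of r] by (simp add: s_def)
    have "(companion a *v window x k) $ r = (\<Sum>j\<in>UNIV. if j = s then x (k + 1 - int (coord j)) else 0)"
      unfolding matrix_vector_mult_def companion_def window_def vec_lambda_beta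
    proof (intro sum.cong refl)
      fix j
      have "coord r = coord j + 1 \<longleftrightarrow> j = s"
        using s False coord_le[of r] coord_eq_iff[of j s] by linarith
      then show "(if coord r = 1 then a (coord j) else if coord r = coord j + 1 then 1 else 0) * x (k + 1 - int (coord j)) =
        (if j = s then x (k + 1 - int (coord j)) else 0)" using False by simp
    qed
    then have "(companion a *v window x k) $ r = x (k + 1 + 1 - int (coord r))"
      using s False coord_le[of r] by (simp add: of_nat_diff algebra_simps)
    moreover have "r \<noteq> coord_inv 1" using False coord_le[of r] by (auto simp: Suc_le_eq)
    ultimately show ?thesis by simp
  qed
  then show ?thesis by (simp add: vec_eq_iff window_def axis_def)
qed

text \<open>\<open>S\<close> is a scalar majorant: it obeys the recursion of a first-order system
  with rate \<open>\<rho>\<close>, and the constant \<open>K\<close> of the power bound multiplies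
  it once.\<close>

lemma norm_window_le:
  fixes x :: "int \<Rightarrow> real" and v S :: "nat \<Rightarrow> real"
  assumes rec: "\<And>k. x (int k + 1) = (\<Sum>i = 1..CARD('p). a i * x (int k + 1 - int i)) + v k"
    and pow: "\<And>n z. norm (((*v) (companion a :: real^'p^'p::finite) ^^ n) z) \<le> K * \<rho> ^ n * norm z"
    and K: "0 \<le> K" and \<rho>: "0 \<le> \<rho>"
    and S0: "norm (window x 0 :: real^'p) \<le> S 0"
    and S: "\<And>k. \<rho> * S k + \<bar>v k\<bar> \<le> S (Suc k)"
  shows "norm (window x (int k) :: real^'p) \<le> K * S k"
proof -
  define L where "L = (*v) (companion a :: real^'p^'p)"
  have lin: "linear (L ^^ n)" for n
  proof (induction n)
    case 0
    show ?case using linear_id by (simp add: id_def)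
  next
    case (Suc n)
    show ?case unfolding funpow.simps L_def
      by (rule linear_compose[OF Suc[unfolded L_def] matrix_vector_mul_linear])
  qed
  \<comment> \<open>Bounding all images \<open>(L ^^ n)\<close> of the state at once keeps
    \<open>K\<close> from accumulating at every step of the induction.\<close>
  have "norm ((L ^^ n) (window x (int k))) \<le> K * \<rho> ^ n * S k" for n
  proof (induction k arbitrary: n)
    case 0
    have "norm ((L ^^ n) (window x 0)) \<le> K * \<rho> ^ n * norm (window x 0 :: real^'p)"
      unfolding L_def by (rule pow)
    also have "\<dots> \<le> K * \<rho> ^ n * S 0" using S0 K \<rho> by (intro mult_left_mono) auto
    finally show ?case by simp
  next
    case (Suc k)
    define e :: "real^'p" where "e = axis (coord_inv 1) 1"
    have "(L ^^ n) (window x (int (Suc k))) = (L ^^ n) (L (window x (int k)) + v k *\<^sub>R e)"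
      using window_Suc[of x "int k" a "v k", OF rec] by (simp add: L_def e_def add.commute)
    also have "\<dots> = (L ^^ Suc n) (window x (int k)) + v k *\<^sub>R (L ^^ n) e"
      by (simp add: linear_add[OF lin] linear_scale[OF lin] funpow_swap1)
    finally have "norm ((L ^^ n) (window x (int (Suc k)))) \<le>
        norm ((L ^^ Suc n) (window x (int k))) + norm (v k *\<^sub>R (L ^^ n) e)"
      by (simp only: norm_triangle_ineq)
    also have "\<dots> \<le> K * \<rho> ^ Suc n * S k + \<bar>v k\<bar> * (K * \<rho> ^ n * norm e)"
      unfolding norm_scaleR using Suc[of "Suc n"] pow[of n e] by (intro add_mono mult_left_mono) (auto simp: L_def)
    also have "\<dots> = K * \<rho> ^ n * (\<rho> * S k + \<bar>v k\<bar>)" by (simp add: e_def algebra_simps)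
    also have "\<dots> \<le> K * \<rho> ^ n * S (Suc k)" using S K \<rho> by (intro mult_left_mono) auto
    finally show ?case .
  qed
  from this[of 0] show ?thesis by simp
qed

text \<open>The inputs cancel in the difference, so only the autoregressive part of \<open>v\<close>
  is tested, against the deviations up to time \<open>k - 1\<close>.\<close>

lemma regressor_diff_inner_le:
  fixes v :: "real^('p::finite + 'q::finite)"
  shows "\<bar>(regressor y u k - regressor y' u k) \<bullet> v\<bar> \<le>
    sqrt (\<Sum>r\<in>UNIV. (v $ Inl r)\<^sup>2) * norm (window (\<lambda>t. y t - y' t) (k - 1) :: real^'p)"
proof -
  define v' :: "real^'p" where "v' = (\<chi> r. v $ Inl r)"
  have "(regressor y u k - regressor y' u k) \<bullet> v = window (\<lambda>t. y t - y' t) (k - 1) \<bullet> v'"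
    by (simp add: inner_vec_def regressor_def stack_def window_def v'_def UNIV_Plus_UNIV[symmetric] sum.Plus
        del: UNIV_Plus_UNIV)
  also have "\<bar>\<dots>\<bar> \<le> norm (window (\<lambda>t. y t - y' t) (k - 1) :: real^'p) * norm v'"
    by (rule Cauchy_Schwarz_ineq2)
  finally show ?thesis
    by (simp add: v'_def norm_vec_def L2_set_def mult.commute)
qed

text \<open>In the application \<open>v\<close> and \<open>t\<close> are the inner products of the
  error with the predicted and the true regressor, \<open>\<alpha>\<close> and
  \<open>\<beta>\<close> the predicted and the true output. The mean value theorem gives the factor
  \<open>- f \<xi> * (\<alpha> - \<beta>)\<close>; since \<open>\<alpha> - \<beta>\<close> is within
  \<open>W\<close> of both \<open>v\<close> and \<open>t\<close>, the product is close to
  \<open>- f \<xi> * t\<^sup>2\<close>.\<close>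

lemma drift_le:
  fixes F f :: "real \<Rightarrow> real"
  assumes deriv: "\<And>x. (F has_real_derivative f x) (at x)"
    and f: "\<And>x. \<bar>x - C\<bar> \<le> R \<Longrightarrow> f\<^sub>m \<le> f x \<and> f x \<le> f\<^sub>M" and "0 \<le> f\<^sub>m"
    and \<alpha>: "\<bar>\<alpha>\<bar> \<le> R" and \<beta>: "\<bar>\<beta>\<bar> \<le> R"
    and diff: "\<alpha> - \<beta> = v + w" "\<alpha> - \<beta> = t + w'"
    and v: "\<bar>v\<bar> \<le> M\<^sub>2 * E" and t: "\<bar>t\<bar> \<le> M\<^sub>1 * E" and w: "\<bar>w\<bar> \<le> W" "\<bar>w'\<bar> \<le> W"
  shows "v * (F (C - \<alpha>) - F (C - \<beta>)) \<le> - f\<^sub>m * t\<^sup>2 + f\<^sub>M * ((M\<^sub>2 + 2 * M\<^sub>1) * E * W)"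
proof -
  obtain \<xi> where \<xi>: "\<bar>\<xi> - C\<bar> \<le> R" and eq: "F (C - \<alpha>) - F (C - \<beta>) = - f \<xi> * (\<alpha> - \<beta>)"
  proof (cases \<alpha> \<beta> rule: linorder_cases)
    case less
    from MVT2[of "C - \<beta>" "C - \<alpha>" F f] less deriv obtain z where
      "C - \<beta> < z" "z < C - \<alpha>" "F (C - \<alpha>) - F (C - \<beta>) = (C - \<alpha> - (C - \<beta>)) * f z" by auto
    then show ?thesis using \<alpha> \<beta> by (intro that[of z]) (auto simp: algebra_simps abs_le_iff)
  next
    case equal
    then show ?thesis using \<alpha> by (intro that[of "C - \<alpha>"]) auto
  next
    case greater
    from MVT2[of "C - \<alpha>" "C - \<beta>" F f] greater deriv obtain z where
      "C - \<alpha> < z" "z < C - \<beta>" "F (C - \<beta>) - F (C - \<alpha>) = (C - \<beta> - (C - \<alpha>)) * f z" by auto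
    then show ?thesis using \<alpha> \<beta> by (intro that[of z]) (auto simp: algebra_simps abs_le_iff)
  qed
  have W: "0 \<le> W" using w by linarith
  have E: "0 \<le> M\<^sub>1 * E" "0 \<le> M\<^sub>2 * E" using t v by linarith+
  define H where "H = (M\<^sub>2 + 2 * M\<^sub>1) * E * W"
  have H: "0 \<le> H" using mult_nonneg_nonneg[OF E(1) W] mult_nonneg_nonneg[OF E(2) W]
    by (simp add: H_def distrib_right)
  \<comment> \<open>Expanding only one of the two factors \<open>v\<close> keeps the constant at \<open>2 * M\<^sub>1\<close>; expanding
    both would cost \<open>4 * M\<^sub>1\<close>.\<close>
  have "v * (v + w) = t\<^sup>2 + t * (w' - w) + v * w'"
  proof -
    have v_eq: "v = t + w' - w" using diff by linarith
    show ?thesis unfolding v_eq by (simp add: power2_eq_square algebra_simps)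
  qed
  moreover have "\<bar>t * (w' - w)\<bar> \<le> (M\<^sub>1 * E) * (2 * W)"
    unfolding abs_mult using t w E by (intro mult_mono) auto
  moreover have "\<bar>v * w'\<bar> \<le> (M\<^sub>2 * E) * W"
    unfolding abs_mult using v w E by (intro mult_mono) auto
  ultimately have lower: "t\<^sup>2 - H \<le> v * (v + w)" by (simp add: H_def algebra_simps)
  \<comment> \<open>The lower bound of the density is charged to the square, the upper bound to the
    cross terms.\<close>
  have "f\<^sub>m * t\<^sup>2 - f\<^sub>M * H \<le> f \<xi> * t\<^sup>2 - f \<xi> * H"
    using f[OF \<xi>] H by (intro diff_mono mult_right_mono) auto
  also have "\<dots> \<le> f \<xi> * (v * (v + w))"
    using mult_left_mono[OF lower, of "f \<xi>"] f[OF \<xi>] assms(3) by (simp add: algebra_simps)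
  finally show ?thesis unfolding eq diff(1) H_def by (simp add: algebra_simps)
qed

text \<open>The part of the deviation of the predicted outputs that is due to initial values and to the
  motion of the estimate, as opposed to its current error.\<close>

primrec transient :: "real \<Rightarrow> real \<Rightarrow> real \<Rightarrow> nat \<Rightarrow> real" where
  "transient \<rho> D c 0 = D"
| "transient \<rho> D c (Suc k) = \<rho> * transient \<rho> D c k + c / real (Suc k)"

lemma transient_nonneg: "0 \<le> \<rho> \<Longrightarrow> 0 \<le> D \<Longrightarrow> 0 \<le> c \<Longrightarrow> 0 \<le> transient \<rho> D c k"
  by (induction k) auto

lemma transient_tendsto_0:
  assumes "0 \<le> \<rho>" "\<rho> < 1" "0 \<le> D" "0 \<le> c"
  shows "transient \<rho> D c \<longlonglongrightarrow> 0"
proof (rule affine_contraction_tendsto_0[OF assms(1,2)])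
  show "(\<lambda>k. c / real (Suc k)) \<longlonglongrightarrow> 0"
    using LIMSEQ_Suc[OF lim_const_over_n[of c]] by simp
qed (use assms in \<open>auto intro: transient_nonneg\<close>)

text \<open>One outcome of the noise is fixed, so everything here is deterministic; of the binary
  observations only their range is retained.\<close>

locale identification_path =
  fixes a b :: "nat \<Rightarrow> real" and y u yh :: "int \<Rightarrow> real"
    and \<theta> :: "real^('p::finite + 'q::finite)" and \<Theta> :: "(real^('p + 'q)) set"
    and \<phi> \<phi>h :: "int \<Rightarrow> real^('p + 'q)" and \<theta>h :: "nat \<Rightarrow> real^('p + 'q)"
    and s :: "nat \<Rightarrow> real" and F f :: "real \<Rightarrow> real"
    and \<gamma> C B M\<^sub>1 M\<^sub>2 f\<^sub>m f\<^sub>M G K \<rho> \<delta> :: real and N :: nat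
  assumes \<theta>: "\<theta> = stack a b" "\<theta> \<in> \<Theta>"
    and \<phi>: "\<phi> = regressor y u" and \<phi>h: "\<phi>h = regressor yh u"
    and y: "\<And>k::nat. k \<ge> 1 \<Longrightarrow> y (int k) = \<phi> (int k) \<bullet> \<theta>"
    and yh: "\<And>k::nat. k \<ge> 1 \<Longrightarrow> yh (int k) = \<phi>h (int k) \<bullet> \<theta>h k"
    and update: "\<And>k::nat. k \<ge> 1 \<Longrightarrow> \<theta>h k = closest_point \<Theta>
      (\<theta>h (k - 1) + (\<gamma> / real k * (F (C - \<phi>h (int k) \<bullet> \<theta>h (k - 1)) - s k)) *\<^sub>R \<phi>h (int k))"
    and \<Theta>: "convex \<Theta>" "closed \<Theta>"
    and \<Theta>_norm: "\<And>v. v \<in> \<Theta> \<Longrightarrow> norm v \<le> B"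
    and \<Theta>_ar: "\<And>v. v \<in> \<Theta> \<Longrightarrow> sqrt (\<Sum>r\<in>UNIV. (v $ Inl r)\<^sup>2) \<le> G"
    and \<gamma>: "0 \<le> \<gamma>"
    and F: "\<And>x. 0 \<le> F x" "\<And>x. F x \<le> 1" "\<And>x. (F has_real_derivative f x) (at x)"
    and s: "\<And>k. k \<ge> 1 \<Longrightarrow> 0 \<le> s k" "\<And>k. k \<ge> 1 \<Longrightarrow> s k \<le> 1"
    and f: "\<And>x. \<bar>x - C\<bar> \<le> B * max M\<^sub>1 M\<^sub>2 \<Longrightarrow> f\<^sub>m \<le> f x \<and> f x \<le> f\<^sub>M" "0 \<le> f\<^sub>m"
    and \<phi>_le: "\<And>k::nat. k \<ge> 1 \<Longrightarrow> norm (\<phi> (int k)) \<le> M\<^sub>1"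
    and \<phi>h_le: "\<And>k::nat. k \<ge> 1 \<Longrightarrow> norm (\<phi>h (int k)) \<le> M\<^sub>2"
    and \<rho>: "0 \<le> \<rho>" "\<rho> < 1" and K: "0 \<le> K"
    and pow: "\<And>n z. norm (((*v) (companion a :: real^'p^'p) ^^ n) z) \<le> K * \<rho> ^ n * norm z"
    and excitation: "\<And>k v. k \<ge> 1 \<Longrightarrow> real N * \<delta> * (v \<bullet> v) \<le> (\<Sum>i<N. (\<phi> (int (k + i)) \<bullet> v)\<^sup>2)"
begin

definition err :: "nat \<Rightarrow> real^('p + 'q)" where
  "err k = \<theta>h k - \<theta>"

definition D\<^sub>0 :: real where
  "D\<^sub>0 = norm (window (\<lambda>t. yh t - y t) 0 :: real^'p)"

text \<open>The forcing constant is the bound \<open>\<gamma> * M\<^sub>2\<close> for the motion of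
  the estimate, times the weight \<open>\<rho> * (M\<^sub>2 / (1 - \<rho>))\<close> with which the
  previous error enters the majorant in \<open>window_le\<close>.\<close>

definition lag :: "nat \<Rightarrow> real" where
  "lag = transient \<rho> D\<^sub>0 (\<rho> * (M\<^sub>2 / (1 - \<rho>)) * (\<gamma> * M\<^sub>2))"

lemma M_nonneg: "0 \<le> M\<^sub>1" "0 \<le> M\<^sub>2"
  using order_trans[OF norm_ge_zero \<phi>_le[of 1]] order_trans[OF norm_ge_zero \<phi>h_le[of 1]] by simp_all

lemma B_nonneg: "0 \<le> B"
  by (rule order_trans[OF norm_ge_zero \<Theta>_norm[OF \<theta>(2)]])

lemma G_nonneg: "0 \<le> G"
  by (rule order_trans[OF real_sqrt_ge_zero \<Theta>_ar[OF \<theta>(2)]]) (simp add: sum_nonneg)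

lemma fM_nonneg: "0 \<le> f\<^sub>M"
  using f(1)[of C] f(2) M_nonneg B_nonneg by (simp add: le_max_iff_disj)

lemma estimate_in: "k \<ge> 1 \<Longrightarrow> \<theta>h k \<in> \<Theta>"
  using update[of k] closest_point_in_set[OF \<Theta>(2)] \<theta>(2) by auto

lemma norm_err_le: "k \<ge> 1 \<Longrightarrow> norm (err k) \<le> 2 * B"
  using norm_triangle_ineq4[of "\<theta>h k" \<theta>] \<Theta>_norm[OF estimate_in, of k] \<Theta>_norm[OF \<theta>(2)]
  by (simp add: err_def)

definition innovation :: "nat \<Rightarrow> real" where
  "innovation k = F (C - \<phi>h (int (Suc k)) \<bullet> \<theta>h k) - s (Suc k)"

lemma abs_innovation_le: "\<bar>innovation k\<bar> \<le> 1"
  using F(1,2)[of "C - \<phi>h (int (Suc k)) \<bullet> \<theta>h k"] s[of "Suc k"] by (simp add: innovation_def)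

text \<open>The projection is nonexpansive and fixes \<open>v\<close>. It is used with
  \<open>v = \<theta>\<close> for the energy and with \<open>v = \<theta>h k\<close> for the size of
  a step.\<close>

lemma norm_update_le:
  "v \<in> \<Theta> \<Longrightarrow> norm (\<theta>h (Suc k) - v) \<le> norm (\<theta>h k - v + (\<gamma> / real (Suc k) * innovation k) *\<^sub>R \<phi>h (int (Suc k)))"
  using closest_point_lipschitz[OF \<Theta>, of "\<theta>h k + (\<gamma> / real (Suc k) * innovation k) *\<^sub>R \<phi>h (int (Suc k))" v]
    closest_point_self[of v \<Theta>] update[of "Suc k"]
  by (auto simp: innovation_def dist_norm algebra_simps)

lemma norm_correction_le:
  "norm ((\<gamma> / real (Suc k) * innovation k) *\<^sub>R \<phi>h (int (Suc k))) \<le> \<gamma> * M\<^sub>2 / real (Suc k)"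
proof -
  have "\<bar>innovation k\<bar> * norm (\<phi>h (int (Suc k))) \<le> 1 * M\<^sub>2"
    using abs_innovation_le \<phi>h_le[of "Suc k"] by (intro mult_mono) auto
  from mult_left_mono[OF this, of "\<gamma> / real (Suc k)"] show ?thesis
    using \<gamma> by (simp add: abs_mult mult.assoc)
qed

text \<open>From index 1 on the estimate lies in \<open>\<Theta>\<close>; the initial one may lie
  outside, and then the first projection can move it far.\<close>

lemma err_step_le:
  assumes "k \<ge> 1"
  shows "norm (err (Suc k) - err k) \<le> \<gamma> * M\<^sub>2 / real (Suc k)"
  using norm_update_le[OF estimate_in[OF assms], of k] norm_correction_le[of k]
  by (simp add: err_def)

lemma err_steps_le:
  assumes "k \<ge> 1"
  shows "norm (err (k + i) - err k) \<le> real i * (\<gamma> * M\<^sub>2 / real (Suc k))"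
proof (induction i)
  case (Suc i)
  have "norm (err (k + Suc i) - err k) \<le> norm (err (Suc (k + i)) - err (k + i)) + norm (err (k + i) - err k)"
    using norm_triangle_ineq[of "err (Suc (k + i)) - err (k + i)" "err (k + i) - err k"] by simp
  moreover have "norm (err (Suc (k + i)) - err (k + i)) \<le> \<gamma> * M\<^sub>2 / real (Suc (k + i))"
    by (rule err_step_le) (use assms in simp)
  moreover have "\<gamma> * M\<^sub>2 / real (Suc (k + i)) \<le> \<gamma> * M\<^sub>2 / real (Suc k)"
    using \<gamma> M_nonneg by (intro divide_left_mono) auto
  moreover have "real (Suc i) * (\<gamma> * M\<^sub>2 / real (Suc k)) = \<gamma> * M\<^sub>2 / real (Suc k) + real i * (\<gamma> * M\<^sub>2 / real (Suc k))"
    by (simp only: of_nat_Suc distrib_right mult_1_left)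
  ultimately show ?case using Suc by linarith
qed simp

lemma err_square_step_le:
  assumes "k \<ge> 1"
  shows "\<bar>err (Suc k) \<bullet> err (Suc k) - err k \<bullet> err k\<bar> \<le> \<gamma> * M\<^sub>2 * (4 * B) / real (Suc k)"
proof -
  have "err (Suc k) \<bullet> err (Suc k) - err k \<bullet> err k = (err (Suc k) - err k) \<bullet> (err (Suc k) + err k)"
    by (simp add: algebra_simps inner_commute)
  also have "\<bar>\<dots>\<bar> \<le> norm (err (Suc k) - err k) * norm (err (Suc k) + err k)"
    by (rule Cauchy_Schwarz_ineq2)
  also have "\<dots> \<le> (\<gamma> * M\<^sub>2 / real (Suc k)) * (4 * B)"
    using err_step_le[OF assms] norm_err_le[OF assms] norm_err_le[of "Suc k"] norm_triangle_ineq[of "err (Suc k)" "err k"]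
      \<gamma> M_nonneg
    by (intro mult_mono) auto
  finally show ?thesis by simp
qed

lemma energy_step:
  "err (Suc k) \<bullet> err (Suc k) \<le> err k \<bullet> err k + 2 * \<gamma> / real (Suc k) * ((err k \<bullet> \<phi>h (int (Suc k))) * innovation k)
      + (\<gamma> * M\<^sub>2 / real (Suc k))\<^sup>2"
proof -
  define w where "w = (\<gamma> / real (Suc k) * innovation k) *\<^sub>R \<phi>h (int (Suc k))"
  have "norm (err (Suc k)) \<le> norm (err k + w)"
    using norm_update_le[OF \<theta>(2), of k] by (simp add: err_def w_def)
  then have "(norm (err (Suc k)))\<^sup>2 \<le> (norm (err k + w))\<^sup>2" by (intro power_mono) auto
  moreover have "(norm (err k + w))\<^sup>2 = err k \<bullet> err k + 2 * (err k \<bullet> w) + (norm w)\<^sup>2"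
    by (simp add: power2_norm_eq_inner inner_add_left inner_add_right inner_commute)
  moreover have "(norm w)\<^sup>2 \<le> (\<gamma> * M\<^sub>2 / real (Suc k))\<^sup>2"
    unfolding w_def by (intro power_mono norm_correction_le) auto
  ultimately show ?thesis
    by (simp add: power2_norm_eq_inner w_def mult_ac del: of_nat_Suc)
qed

text \<open>The output deviation splits into the difference of the regressors tested against
  \<open>\<theta>\<close>, which is the autoregression with coefficients \<open>a\<close>, and the
  driving term \<open>\<phi>h \<bullet> err\<close>.\<close>

lemma window_le:
  assumes "k \<ge> 1"
  shows "norm (window (\<lambda>t. yh t - y t) (int k) :: real^'p) \<le> K * (M\<^sub>2 / (1 - \<rho>) * norm (err k) + lag k)"
proof -
  define v where "v k = \<phi>h (int (Suc k)) \<bullet> err (Suc k)" for k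
  \<comment> \<open>The first summand is the stationary response to forcing of size
    \<open>M\<^sub>2 * norm (err k)\<close>: its coefficient solves
    \<open>c = \<rho> * c + M\<^sub>2\<close>. It is left out at time 0, where the motion of the
    estimate is not controlled.\<close>
  define S where "S k = (if k = 0 then 0 else M\<^sub>2 / (1 - \<rho>) * norm (err k)) + lag k" for k
  have v: "\<bar>v k\<bar> \<le> M\<^sub>2 * norm (err (Suc k))" for k
    unfolding v_def
    by (rule order_trans[OF Cauchy_Schwarz_ineq2 mult_right_mono[OF \<phi>h_le]]) auto
  have "norm (window (\<lambda>t. yh t - y t) (int k) :: real^'p) \<le> K * S k"
  proof (rule norm_window_le[where a = a and v = v, OF _ pow K \<rho>(1)])
    fix k
    have "yh (int k + 1) - y (int k + 1) = \<phi>h (int k + 1) \<bullet> \<theta>h (Suc k) - \<phi> (int k + 1) \<bullet> \<theta>"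
      using y[of "Suc k"] yh[of "Suc k"] by (simp add: add.commute)
    also have "\<dots> = (\<phi>h (int k + 1) \<bullet> \<theta> - \<phi> (int k + 1) \<bullet> \<theta>) + v k"
      by (simp add: v_def err_def inner_diff_right add.commute)
    also have "\<phi>h (int k + 1) \<bullet> \<theta> - \<phi> (int k + 1) \<bullet> \<theta> = (\<Sum>i = 1..CARD('p). a i * (yh (int k + 1 - int i) - y (int k + 1 - int i)))"
      unfolding \<phi> \<phi>h \<theta>(1) regressor_def inner_stack
      by (simp add: sum_subtractf[symmetric] algebra_simps)
    finally show "yh (int k + 1) - y (int k + 1) = (\<Sum>i = 1..CARD('p). a i * (yh (int k + 1 - int i) - y (int k + 1 - int i))) + v k" .
  next
    show "norm (window (\<lambda>t. yh t - y t) 0 :: real^'p) \<le> S 0" by (simp add: S_def lag_def D\<^sub>0_def)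
  next
    fix k
    define c where "c = M\<^sub>2 / (1 - \<rho>)"
    have c: "0 \<le> c" "c = \<rho> * c + M\<^sub>2"
      using M_nonneg \<rho> by (auto simp: c_def field_simps)
    have lag: "lag (Suc k) = \<rho> * lag k + \<rho> * c * (\<gamma> * M\<^sub>2) / real (Suc k)"
      by (simp add: lag_def c_def)
    show "\<rho> * S k + \<bar>v k\<bar> \<le> S (Suc k)"
    proof (cases "k = 0")
      case True
      have "M\<^sub>2 * norm (err (Suc k)) \<le> c * norm (err (Suc k))"
        using c(2) mult_nonneg_nonneg[OF \<rho>(1) c(1)] by (intro mult_right_mono) auto
      moreover have "0 \<le> \<rho> * c * (\<gamma> * M\<^sub>2) / real (Suc k)"
        using c \<rho> \<gamma> M_nonneg by simp
      moreover have "\<rho> * S k = \<rho> * lag k" "S (Suc k) = c * norm (err (Suc k)) + lag (Suc k)"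
        using True by (simp_all add: S_def c_def)
      ultimately show ?thesis using v[of k] lag by linarith
    next
      case False
      have "norm (err k) \<le> norm (err (Suc k)) + \<gamma> * M\<^sub>2 / real (Suc k)"
        using err_step_le[of k] norm_triangle_ineq4[of "err (Suc k)" "err (Suc k) - err k"] False by simp
      then have "\<rho> * c * norm (err k) \<le> \<rho> * c * (norm (err (Suc k)) + \<gamma> * M\<^sub>2 / real (Suc k))"
        using c \<rho> by (intro mult_left_mono) auto
      moreover have "c * norm (err (Suc k)) = \<rho> * c * norm (err (Suc k)) + M\<^sub>2 * norm (err (Suc k))"
        by (subst c(2)) (simp add: distrib_right)
      moreover have "\<rho> * c * (norm (err (Suc k)) + \<gamma> * M\<^sub>2 / real (Suc k))
          = \<rho> * c * norm (err (Suc k)) + \<rho> * c * (\<gamma> * M\<^sub>2) / real (Suc k)"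
        by (simp only: distrib_left times_divide_eq_right)
      moreover have "\<rho> * S k = \<rho> * c * norm (err k) + \<rho> * lag k" "S (Suc k) = c * norm (err (Suc k)) + lag (Suc k)"
        using False by (simp_all add: S_def c_def distrib_left)
      ultimately show ?thesis using v[of k] lag by linarith
    qed
  qed
  then show ?thesis using assms by (simp add: S_def)
qed

text \<open>With \<open>G\<close> the square root of \<open>g_bound\<close>, this is the term
  subtracted in the convergence condition.\<close>

definition coupling :: real where
  "coupling = f\<^sub>M * G * M\<^sub>2 * K / (1 - \<rho>) * (M\<^sub>2 + 2 * M\<^sub>1)"

text \<open>This is the first-order term of \<open>energy_step\<close> with the observation replaced
  by its mean. \<open>W\<close> bounds the regressor deviation tested against any point of
  \<open>\<Theta>\<close>, in particular against both \<open>\<theta>\<close> and the current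
  estimate.\<close>

lemma drift:
  assumes k: "k \<ge> 1"
  shows "(err k \<bullet> \<phi>h (int (Suc k))) * (F (C - \<phi>h (int (Suc k)) \<bullet> \<theta>h k) - F (C - y (int (Suc k))))
    \<le> - f\<^sub>m * (\<phi> (int (Suc k)) \<bullet> err k)\<^sup>2 + coupling * (err k \<bullet> err k)
      + f\<^sub>M * (M\<^sub>2 + 2 * M\<^sub>1) * G * K * (2 * B) * lag k"
proof -
  define E where "E = norm (err k)"
  define W where "W = G * (K * (M\<^sub>2 / (1 - \<rho>) * E + lag k))"
  define n where "n = int (Suc k)"
  have 1: "norm (\<phi> n) \<le> M\<^sub>1" "norm (\<phi>h n) \<le> M\<^sub>2" "y n = \<phi> n \<bullet> \<theta>"
    using \<phi>_le[of "Suc k"] \<phi>h_le[of "Suc k"] y[of "Suc k"] by (simp_all add: n_def)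
  have inner_le: "\<bar>x \<bullet> w\<bar> \<le> m * e" if "norm x \<le> m" "norm w \<le> e" for x w :: "real^('p + 'q)" and m e
    by (rule order_trans[OF Cauchy_Schwarz_ineq2 mult_mono[OF that]])
      (auto intro: order_trans[OF norm_ge_zero that(1)])
  have W: "\<bar>(\<phi>h n - \<phi> n) \<bullet> w\<bar> \<le> W" if "w \<in> \<Theta>" for w
  proof -
    have "\<bar>(\<phi>h n - \<phi> n) \<bullet> w\<bar> \<le> sqrt (\<Sum>r\<in>UNIV. (w $ Inl r)\<^sup>2) * norm (window (\<lambda>t. yh t - y t) (n - 1) :: real^'p)"
      unfolding \<phi> \<phi>h by (rule regressor_diff_inner_le)
    also have "\<dots> \<le> W" unfolding W_def E_def
      using \<Theta>_ar[OF that] window_le[OF k] G_nonneg by (intro mult_mono) (auto simp: n_def)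
    finally show ?thesis .
  qed
  have "(\<phi>h n \<bullet> err k) * (F (C - \<phi>h n \<bullet> \<theta>h k) - F (C - \<phi> n \<bullet> \<theta>))
    \<le> - f\<^sub>m * (\<phi> n \<bullet> err k)\<^sup>2 + f\<^sub>M * ((M\<^sub>2 + 2 * M\<^sub>1) * E * W)"
  proof (rule drift_le[where f = f and R = "B * max M\<^sub>1 M\<^sub>2" and w = "(\<phi>h n - \<phi> n) \<bullet> \<theta>" and w' = "(\<phi>h n - \<phi> n) \<bullet> \<theta>h k"])
    have "\<bar>\<phi>h n \<bullet> \<theta>h k\<bar> \<le> max M\<^sub>1 M\<^sub>2 * B" "\<bar>\<phi> n \<bullet> \<theta>\<bar> \<le> max M\<^sub>1 M\<^sub>2 * B"
      using 1 \<Theta>_norm[OF estimate_in[OF k]] \<Theta>_norm[OF \<theta>(2)] by (auto intro!: inner_le)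
    then show "\<bar>\<phi>h n \<bullet> \<theta>h k\<bar> \<le> B * max M\<^sub>1 M\<^sub>2" "\<bar>\<phi> n \<bullet> \<theta>\<bar> \<le> B * max M\<^sub>1 M\<^sub>2"
      by (simp_all add: mult.commute)
    show "\<phi>h n \<bullet> \<theta>h k - \<phi> n \<bullet> \<theta> = \<phi>h n \<bullet> err k + (\<phi>h n - \<phi> n) \<bullet> \<theta>"
      "\<phi>h n \<bullet> \<theta>h k - \<phi> n \<bullet> \<theta> = \<phi> n \<bullet> err k + (\<phi>h n - \<phi> n) \<bullet> \<theta>h k"
      by (simp_all add: err_def algebra_simps)
    show "\<bar>\<phi>h n \<bullet> err k\<bar> \<le> M\<^sub>2 * E" "\<bar>\<phi> n \<bullet> err k\<bar> \<le> M\<^sub>1 * E"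
      using 1 by (auto intro!: inner_le simp: E_def)
  qed (use F f W[OF \<theta>(2)] W[OF estimate_in[OF k]] in auto)
  also have "f\<^sub>M * ((M\<^sub>2 + 2 * M\<^sub>1) * E * W) = coupling * E\<^sup>2 + f\<^sub>M * (M\<^sub>2 + 2 * M\<^sub>1) * G * K * E * lag k"
    by (simp add: W_def coupling_def power2_eq_square algebra_simps)
  \<comment> \<open>In the \<open>lag\<close> term the error is replaced by its bound
    \<open>2 * B\<close>, so that the remainder no longer depends on the error.\<close>
  also have "\<dots> \<le> coupling * E\<^sup>2 + f\<^sub>M * (M\<^sub>2 + 2 * M\<^sub>1) * G * K * (2 * B) * lag k"
    using norm_err_le[OF k] fM_nonneg M_nonneg G_nonneg K \<rho> \<gamma>
    by (intro add_left_mono mult_right_mono mult_left_mono)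
      (auto simp: E_def lag_def D\<^sub>0_def intro!: transient_nonneg)
  finally show ?thesis
    using 1 by (simp add: n_def E_def power2_norm_eq_inner inner_commute)
qed

text \<open>Excitation concerns one fixed vector, here \<open>err k\<close>; within a window the
  error moves by order 1/k only, so using the current error in each summand costs a vanishing
  amount.\<close>

lemma windowed_excitation:
  assumes k: "k \<ge> 1"
  shows "real N * \<delta> * (err k \<bullet> err k) - real N * (4 * B * M\<^sub>1\<^sup>2 * (real N * (\<gamma> * M\<^sub>2 / real (Suc k))))
    \<le> (\<Sum>i<N. (\<phi> (int (Suc (k + i))) \<bullet> err (k + i))\<^sup>2)"
proof -
  \<comment> \<open>The difference of two squares factors into a difference, bounded by
    \<open>M\<^sub>1\<close> times the drift, and a sum, bounded by
    \<open>M\<^sub>1 * (4 * B)\<close>.\<close>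
  define c where "c = 4 * B * M\<^sub>1\<^sup>2 * (real N * (\<gamma> * M\<^sub>2 / real (Suc k)))"
  have each: "(\<phi> (int (Suc (k + i))) \<bullet> err k)\<^sup>2 - c \<le> (\<phi> (int (Suc (k + i))) \<bullet> err (k + i))\<^sup>2" if i: "i < N" for i
  proof -
    define p where "p = \<phi> (int (Suc (k + i)))"
    have p: "norm p \<le> M\<^sub>1" using \<phi>_le[of "Suc (k + i)"] by (simp add: p_def)
    have "\<bar>p \<bullet> (err (k + i) - err k)\<bar> \<le> M\<^sub>1 * (real N * (\<gamma> * M\<^sub>2 / real (Suc k)))"
    proof -
      have "\<bar>p \<bullet> (err (k + i) - err k)\<bar> \<le> norm p * norm (err (k + i) - err k)" by (rule Cauchy_Schwarz_ineq2)
      also have "\<dots> \<le> M\<^sub>1 * (real i * (\<gamma> * M\<^sub>2 / real (Suc k)))"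
        using p err_steps_le[OF k] M_nonneg by (intro mult_mono) auto
      also have "\<dots> \<le> M\<^sub>1 * (real N * (\<gamma> * M\<^sub>2 / real (Suc k)))"
        using i M_nonneg \<gamma> by (intro mult_left_mono mult_right_mono) auto
      finally show ?thesis .
    qed
    moreover have "\<bar>p \<bullet> (err (k + i) + err k)\<bar> \<le> M\<^sub>1 * (4 * B)"
    proof -
      have "\<bar>p \<bullet> (err (k + i) + err k)\<bar> \<le> norm p * norm (err (k + i) + err k)" by (rule Cauchy_Schwarz_ineq2)
      also have "\<dots> \<le> M\<^sub>1 * (4 * B)"
        using p norm_err_le[OF k] norm_err_le[of "k + i"] k norm_triangle_ineq[of "err (k + i)" "err k"] M_nonneg
        by (intro mult_mono) auto
      finally show ?thesis .
    qed
    ultimately have "\<bar>p \<bullet> (err (k + i) - err k)\<bar> * \<bar>p \<bullet> (err (k + i) + err k)\<bar>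
        \<le> (M\<^sub>1 * (real N * (\<gamma> * M\<^sub>2 / real (Suc k)))) * (M\<^sub>1 * (4 * B))"
      using M_nonneg B_nonneg \<gamma> by (intro mult_mono) auto
    also have "\<dots> = c" by (simp add: c_def power2_eq_square)
    finally have "\<bar>(p \<bullet> (err (k + i) - err k)) * (p \<bullet> (err (k + i) + err k))\<bar> \<le> c" by (simp add: abs_mult)
    moreover have "(p \<bullet> (err (k + i) - err k)) * (p \<bullet> (err (k + i) + err k)) = (p \<bullet> err (k + i))\<^sup>2 - (p \<bullet> err k)\<^sup>2"
      by (simp add: inner_diff_right inner_add_right power2_eq_square algebra_simps)
    ultimately show ?thesis unfolding p_def[symmetric] by linarith
  qed
  have "real N * \<delta> * (err k \<bullet> err k) - real N * c \<le> (\<Sum>i<N. (\<phi> (int (Suc (k + i))) \<bullet> err k)\<^sup>2 - c)"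
    using excitation[of "Suc k" "err k"] by (simp add: sum_subtractf)
  also have "\<dots> \<le> (\<Sum>i<N. (\<phi> (int (Suc (k + i))) \<bullet> err (k + i))\<^sup>2)" by (intro sum_mono each) auto
  finally show ?thesis by (simp add: c_def)
qed

end

section \<open>Mean square convergence\<close>

context prob_space
begin

text \<open>The sigma-algebra of a block of noise variables. Pulling back the product sigma-algebra
  along the whole tuple gives the form in which independence of disjoint blocks is
  available.\<close>

definition generated :: "('i \<Rightarrow> 'a \<Rightarrow> real) \<Rightarrow> 'i set \<Rightarrow> 'a measure" where
  "generated d I = vimage_algebra (space M) (\<lambda>\<omega>. \<lambda>i\<in>I. d i \<omega>) (PiM I (\<lambda>_. borel))"

lemma space_generated [simp]: "space (generated d I) = space M"
  by (simp add: generated_def)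

lemma measurable_generated:
  assumes "i \<in> I"
  shows "d i \<in> borel_measurable (generated d I)"
proof -
  have "(\<lambda>\<omega>. \<lambda>i\<in>I. d i \<omega>) \<in> measurable (generated d I) (PiM I (\<lambda>_. borel))"
    unfolding generated_def by (rule measurable_vimage_algebra1) (auto simp: space_PiM)
  from measurable_compose[OF this measurable_component_singleton[of i]] assms show ?thesis by simp
qed

lemma sets_generated_subset:
  assumes "\<And>i. i \<in> I \<Longrightarrow> random_variable borel (d i)"
  shows "sets (generated d I) \<subseteq> events"
proof -
  have "(\<lambda>\<omega>. \<lambda>i\<in>I. d i \<omega>) \<in> measurable M (PiM I (\<lambda>_. borel))"
    using assms by (intro measurable_restrict) auto
  from measurable_sets[OF this] show ?thesis
    unfolding generated_def sets_vimage_algebra by (intro sets.sigma_sets_subset) auto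
qed

lemma sigma_sets_vimage_subset_generated:
  assumes "g \<in> measurable (generated d I) N"
  shows "sigma_sets (space M) {g -` A \<inter> space M |A. A \<in> sets N} \<subseteq> sets (generated d I)"
  using sets.sigma_sets_subset[of "{g -` A \<inter> space M |A. A \<in> sets N}" "generated d I"] measurable_sets[OF assms]
  by auto

text \<open>\<open>g\<close> depends on the noise up to time \<open>k\<close> only, so it is
  independent of \<open>d (Suc k)\<close> and the expectation factors. A constant threshold
  \<open>c\<close> suffices, because the noise-free output is deterministic.\<close>

lemma expectation_past_mult_indicator:
  fixes d :: "nat \<Rightarrow> 'a \<Rightarrow> real" and g :: "'a \<Rightarrow> real"
  assumes indep: "indep_vars (\<lambda>_. borel) d {1..}"
    and g: "g \<in> borel_measurable (generated d {1..k})" "integrable M g"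
  shows "expectation (\<lambda>\<omega>. g \<omega> * indicator {..c} (d (Suc k) \<omega>)) = expectation g * cdf (distr M borel (d (Suc k))) c"
proof -
  have d: "random_variable borel (d i)" if "1 \<le> i" for i
    using indep that by (simp add: indep_vars_def)
  let ?Z = "\<lambda>\<omega>. indicator {..c} (d (Suc k) \<omega>) :: real"
  have Z: "?Z \<in> borel_measurable (generated d {Suc k})" "random_variable borel ?Z"
    using measurable_generated[of "Suc k" "{Suc k}" d] d[of "Suc k"] by measurable
  have "indep_var (PiM {1..k} (\<lambda>_. borel)) (\<lambda>\<omega>. \<lambda>i\<in>{1..k}. d i \<omega>) (PiM {Suc k} (\<lambda>_. borel)) (\<lambda>\<omega>. \<lambda>i\<in>{Suc k}. d i \<omega>)"
    by (rule indep_var_restrict[OF indep]) auto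
  then have XZ: "indep_set (sets (generated d {1..k})) (sets (generated d {Suc k}))"
    unfolding indep_var_eq generated_def sets_vimage_algebra by blast
  have "indep_var borel g borel ?Z"
    unfolding indep_var_eq
  proof (intro conjI)
    show "random_variable borel g" using g(2) by simp
    show "random_variable borel ?Z" by (rule Z(2))
    show "indep_set (sigma_sets (space M) {g -` A \<inter> space M |A. A \<in> sets borel})
      (sigma_sets (space M) {?Z -` A \<inter> space M |A. A \<in> sets borel})"
      using XZ unfolding indep_set_def
      by (rule indep_sets_mono_sets)
        (use sigma_sets_vimage_subset_generated[OF g(1)] sigma_sets_vimage_subset_generated[OF Z(1)] in \<open>auto split: bool.split\<close>)
  qed
  moreover have "integrable M ?Z"
    using d[of "Suc k"] by (intro integrable_const_bound[of _ 1]) (auto simp: indicator_def)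
  ultimately have "expectation (\<lambda>\<omega>. g \<omega> * ?Z \<omega>) = expectation g * expectation ?Z"
    using g(2) by (intro indep_var_lebesgue_integral)
  also have "expectation ?Z = cdf (distr M borel (d (Suc k))) c"
  proof -
    have "expectation ?Z = expectation (indicator (d (Suc k) -` {..c} \<inter> space M))"
      by (intro Bochner_Integration.integral_cong) (auto simp: indicator_def)
    also have "\<dots> = prob (d (Suc k) -` {..c} \<inter> space M)"
      using d[of "Suc k"] by (simp add: measurable_sets)
    also have "\<dots> = cdf (distr M borel (d (Suc k))) c"
      using d[of "Suc k"] by (simp add: cdf_def measure_distr)
    finally show ?thesis .
  qed
  finally show ?thesis .
qed

end

section \<open>Measurability of the estimates with respect to past noise\<close>

lemma borel_measurable_regressor:
  assumes "\<And>t. t < k \<Longrightarrow> (\<lambda>\<omega>. y t \<omega>) \<in> borel_measurable M"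
  shows "(\<lambda>\<omega>. regressor (\<lambda>t. y t \<omega>) u k :: real^('p::finite + 'q::finite)) \<in> borel_measurable M"
proof -
  have "(\<lambda>\<omega>. (regressor (\<lambda>t. y t \<omega>) u k :: real^('p + 'q)) $ i) \<in> borel_measurable M" for i
  proof (cases i)
    case (Inl r)
    have "k - int (coord r) < k" using coord_le[of r] by simp
    then show ?thesis using assms Inl by (simp add: regressor_def stack_def)
  qed (simp add: regressor_def stack_def)
  then show ?thesis
    by (intro iffD2[OF borel_measurable_euclidean_space]) (auto simp: Basis_vec_def inner_axis)
qed

text \<open>Induction along the algorithm: the estimate at time \<open>k\<close> uses observations
  up to \<open>k\<close>, and the next regressor uses predicted outputs up to \<open>k\<close>.
  Taking for \<open>M\<close> the history up to \<open>k\<close> shows that both depend on past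
  noise only.\<close>

lemma measurable_estimates:
  fixes \<theta>h :: "nat \<Rightarrow> 'w \<Rightarrow> real^('p::finite + 'q::finite)" and \<phi>h :: "int \<Rightarrow> 'w \<Rightarrow> real^('p + 'q)"
    and yh :: "int \<Rightarrow> 'w \<Rightarrow> real" and s :: "nat \<Rightarrow> 'w \<Rightarrow> real"
  assumes init: "\<And>\<omega>. \<omega> \<in> space M \<Longrightarrow> \<theta>h 0 \<omega> = \<theta>\<^sub>0"
      "\<And>k \<omega>. k \<le> 0 \<Longrightarrow> \<omega> \<in> space M \<Longrightarrow> yh k \<omega> = y\<^sub>0 k"
    and \<phi>h: "\<And>k \<omega>. \<omega> \<in> space M \<Longrightarrow> \<phi>h k \<omega> = regressor (\<lambda>t. yh t \<omega>) u k"
    and yh: "\<And>k \<omega>. k \<ge> 1 \<Longrightarrow> \<omega> \<in> space M \<Longrightarrow> yh (int k) \<omega> = \<phi>h (int k) \<omega> \<bullet> \<theta>h k \<omega>"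
    and update: "\<And>k \<omega>. k \<ge> 1 \<Longrightarrow> \<omega> \<in> space M \<Longrightarrow> \<theta>h k \<omega> = closest_point \<Theta>
      (\<theta>h (k - 1) \<omega> + (\<gamma> / real k * (F (C - \<phi>h (int k) \<omega> \<bullet> \<theta>h (k - 1) \<omega>) - s k \<omega>)) *\<^sub>R \<phi>h (int k) \<omega>)"
    and \<Theta>: "convex \<Theta>" "closed \<Theta>" "\<Theta> \<noteq> {}" and F: "F \<in> borel_measurable borel"
    and s: "\<And>k. 1 \<le> k \<Longrightarrow> k \<le> n \<Longrightarrow> s k \<in> borel_measurable M"
  shows "k \<le> n \<Longrightarrow> \<theta>h k \<in> borel_measurable M" "k \<le> n \<Longrightarrow> \<phi>h (int (Suc k)) \<in> borel_measurable M"
proof -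
  have \<phi>h_meas: "\<phi>h k \<in> borel_measurable M" if "\<And>t. t < k \<Longrightarrow> yh t \<in> borel_measurable M" for k
    using borel_measurable_regressor[of k yh M u, OF that] by (simp add: \<phi>h cong: measurable_cong)
  have proj: "closest_point \<Theta> \<in> borel_measurable borel"
    by (intro borel_measurable_continuous_onI continuous_on_closest_point \<Theta>)
  \<comment> \<open>The predicted outputs are carried along for all earlier times, nonpositive ones
    included, since a regressor may reach back to initial values.\<close>
  have "\<theta>h k \<in> borel_measurable M \<and> (\<forall>t\<le>int k. yh t \<in> borel_measurable M)" if "k \<le> n" for k
    using that
  proof (induction k)
    case 0
    show ?case by (auto simp: init cong: measurable_cong)
  next
    case (Suc k)
    then have IH: "\<theta>h k \<in> borel_measurable M" "\<And>t. t \<le> int k \<Longrightarrow> yh t \<in> borel_measurable M" by auto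
    have \<phi>: "\<phi>h (int (Suc k)) \<in> borel_measurable M"
      by (rule \<phi>h_meas) (simp add: IH(2))
    have "(\<lambda>\<omega>. closest_point \<Theta> (\<theta>h k \<omega> + (\<gamma> / real (Suc k) * (F (C - \<phi>h (int (Suc k)) \<omega> \<bullet> \<theta>h k \<omega>) - s (Suc k) \<omega>)) *\<^sub>R \<phi>h (int (Suc k)) \<omega>))
      \<in> borel_measurable M"
      using Suc.prems
      by (intro measurable_compose[OF _ proj] borel_measurable_add borel_measurable_scaleR borel_measurable_times
          borel_measurable_diff borel_measurable_const borel_measurable_inner measurable_compose[OF _ F] IH \<phi> s) auto
    then have \<theta>: "\<theta>h (Suc k) \<in> borel_measurable M"
      using update[of "Suc k"] by (simp cong: measurable_cong)
    then have "yh (int (Suc k)) \<in> borel_measurable M"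
      using \<phi> yh[of "Suc k"] by (simp cong: measurable_cong del: of_nat_Suc)
    moreover have "t \<le> int k \<or> t = int (Suc k)" if "t \<le> int (Suc k)" for t using that by auto
    ultimately show ?case using IH(2) \<theta> by blast
  qed
  then show "k \<le> n \<Longrightarrow> \<theta>h k \<in> borel_measurable M" "k \<le> n \<Longrightarrow> \<phi>h (int (Suc k)) \<in> borel_measurable M"
    by (auto intro!: \<phi>h_meas)
qed

lemma mono_imp_derivative_nonneg:
  fixes F :: "real \<Rightarrow> real"
  assumes "mono F" "(F has_real_derivative D) (at x)"
  shows "0 \<le> D"
proof (rule ccontr)
  assume "\<not> 0 \<le> D"
  with DERIV_neg_dec_right[OF assms(2)]
  obtain e where e: "0 < e" "\<And>h. 0 < h \<Longrightarrow> h < e \<Longrightarrow> F (x + h) < F x"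
    by (auto simp: not_le)
  then have "F (x + e / 2) < F x" by simp
  moreover have "F x \<le> F (x + e / 2)" using monoD[OF assms(1), of x "x + e / 2"] e(1) by simp
  ultimately show False by simp
qed

text \<open>The path-wise inequalities hold almost surely and are integrated; independence of the
  noise enters where the observation is replaced by its mean.\<close>

lemma (in prob_space) mean_square_convergence:
  fixes d :: "nat \<Rightarrow> 'a \<Rightarrow> real" and \<theta>h :: "nat \<Rightarrow> 'a \<Rightarrow> real^('p::finite + 'q::finite)"
    and \<phi>h :: "int \<Rightarrow> 'a \<Rightarrow> real^('p + 'q)"
  assumes path: "AE \<omega> in M. identification_path a b y u (\<lambda>t. yh t \<omega>) \<theta> \<Theta> \<phi> (\<lambda>k. \<phi>h k \<omega>) (\<lambda>k. \<theta>h k \<omega>)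
      (\<lambda>k. s k \<omega>) F f \<gamma> C B M\<^sub>1 M\<^sub>2 f\<^sub>m f\<^sub>M G K \<rho> \<delta> N"
    and D: "\<And>\<omega>. \<omega> \<in> space M \<Longrightarrow> norm (window (\<lambda>t. yh t \<omega> - y t) 0 :: real^'p) = D"
    and indep: "indep_vars (\<lambda>_. borel) d {1..}" and cdf: "\<And>k. k \<ge> 1 \<Longrightarrow> cdf (distr M borel (d k)) = F"
    and s: "\<And>k \<omega>. \<omega> \<in> space M \<Longrightarrow> s (Suc k) \<omega> = indicator {..C - y (int (Suc k))} (d (Suc k) \<omega>)"
    and meas: "\<And>k. \<theta>h k \<in> borel_measurable (generated d {1..k})"
      "\<And>k. \<phi>h (int (Suc k)) \<in> borel_measurable (generated d {1..k})"
    and N: "N > 0" and \<gamma>: "\<gamma> > 0"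
    and gap: "f\<^sub>M * G * M\<^sub>2 * K / (1 - \<rho>) * (M\<^sub>2 + 2 * M\<^sub>1) < f\<^sub>m * \<delta>"
  shows "(\<lambda>k. expectation (\<lambda>\<omega>. (\<theta>h k \<omega> - \<theta>) \<bullet> (\<theta>h k \<omega> - \<theta>))) \<longlonglongrightarrow> 0"
proof -
  define \<beta> where "\<beta> = f\<^sub>M * G * M\<^sub>2 * K / (1 - \<rho>) * (M\<^sub>2 + 2 * M\<^sub>1)"
  define e where "e k \<omega> = \<theta>h k \<omega> - \<theta>" for k \<omega>
  define X where "X k \<omega> = e k \<omega> \<bullet> e k \<omega>" for k \<omega>
  define g where "g k \<omega> = e k \<omega> \<bullet> \<phi>h (int (Suc k)) \<omega>" for k \<omega>
  define h where "h k \<omega> = F (C - \<phi>h (int (Suc k)) \<omega> \<bullet> \<theta>h k \<omega>)" for k \<omega>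
  define t where "t k \<omega> = (\<phi> (int (Suc k)) \<bullet> e k \<omega>)\<^sup>2" for k \<omega>
  \<comment> \<open>The initial deviation \<open>D\<close> is common to all outcomes, so this is
    \<open>lag\<close> on every path and the remainders below are deterministic.\<close>
  define l where "l = transient \<rho> D (\<rho> * (M\<^sub>2 / (1 - \<rho>)) * (\<gamma> * M\<^sub>2))"
  define c where "c k = f\<^sub>M * (M\<^sub>2 + 2 * M\<^sub>1) * G * K * (2 * B) * l k" for k
  define x where "x k = real N * (4 * B * M\<^sub>1\<^sup>2 * (real N * (\<gamma> * M\<^sub>2 / real (Suc k))))" for k
  \<comment> \<open>A single admissible path supplies the facts about constants and about
    \<open>F\<close> that do not depend on the outcome.\<close>
  obtain \<omega>\<^sub>0 where "identification_path a b y u (\<lambda>t. yh t \<omega>\<^sub>0) \<theta> \<Theta> \<phi> (\<lambda>k. \<phi>h k \<omega>\<^sub>0) (\<lambda>k. \<theta>h k \<omega>\<^sub>0)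
      (\<lambda>k. s k \<omega>\<^sub>0) F f \<gamma> C B M\<^sub>1 M\<^sub>2 f\<^sub>m f\<^sub>M G K \<rho> \<delta> N"
    using eventually_happens'[OF ae_filter_bot path] by blast
  then interpret P: identification_path a b y u "\<lambda>t. yh t \<omega>\<^sub>0" \<theta> \<Theta> \<phi> "\<lambda>k. \<phi>h k \<omega>\<^sub>0" "\<lambda>k. \<theta>h k \<omega>\<^sub>0"
      "\<lambda>k. s k \<omega>\<^sub>0" F f \<gamma> C B M\<^sub>1 M\<^sub>2 f\<^sub>m f\<^sub>M G K \<rho> \<delta> N .
  note nonneg = P.M_nonneg P.B_nonneg P.G_nonneg P.fM_nonneg
  have D0: "0 \<le> D"
    using not_empty D norm_ge_zero by (metis ex_in_conv)
  have AE_path: "AE \<omega> in M. X k \<omega> \<le> (2 * B)\<^sup>2 \<and> t k \<omega> \<le> (M\<^sub>1 * (2 * B))\<^sup>2 \<and> \<bar>g k \<omega>\<bar> \<le> 2 * B * M\<^sub>2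
      \<and> \<bar>X (Suc k) \<omega> - X k \<omega>\<bar> \<le> \<gamma> * M\<^sub>2 * (4 * B) / real (Suc k)
      \<and> X (Suc k) \<omega> \<le> X k \<omega> + 2 * \<gamma> / real (Suc k) * (g k \<omega> * (h k \<omega> - s (Suc k) \<omega>)) + (\<gamma> * M\<^sub>2 / real (Suc k))\<^sup>2
      \<and> g k \<omega> * (h k \<omega> - F (C - y (int (Suc k)))) \<le> - f\<^sub>m * t k \<omega> + \<beta> * X k \<omega> + c k
      \<and> real N * \<delta> * X k \<omega> - x k \<le> (\<Sum>i<N. t (k + i) \<omega>)"
    if k: "k \<ge> 1" for k
    using path AE_space
  proof eventually_elim
    case (elim \<omega>)
    interpret identification_path a b y u "\<lambda>t. yh t \<omega>" \<theta> \<Theta> \<phi> "\<lambda>k. \<phi>h k \<omega>" "\<lambda>k. \<theta>h k \<omega>"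
      "\<lambda>k. s k \<omega>" F f \<gamma> C B M\<^sub>1 M\<^sub>2 f\<^sub>m f\<^sub>M G K \<rho> \<delta> N by (rule elim(1))
    have err: "err k = e k \<omega>" for k by (simp add: err_def e_def)
    have lag: "lag k = l k" for k by (simp add: lag_def D\<^sub>0_def l_def D[OF elim(2)])
    have "X k \<omega> \<le> (2 * B)\<^sup>2"
      using power_mono[OF norm_err_le[OF k], of 2] by (simp add: err X_def power2_norm_eq_inner)
    moreover have "\<bar>\<phi> (int (Suc k)) \<bullet> e k \<omega>\<bar> \<le> M\<^sub>1 * (2 * B)"
      by (rule order_trans[OF Cauchy_Schwarz_ineq2 mult_mono])
        (use \<phi>_le[of "Suc k"] norm_err_le[OF k] nonneg in \<open>auto simp: err\<close>)
    then have "t k \<omega> \<le> (M\<^sub>1 * (2 * B))\<^sup>2"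
      unfolding t_def using power_mono[of "\<bar>\<phi> (int (Suc k)) \<bullet> e k \<omega>\<bar>" "M\<^sub>1 * (2 * B)" 2] by simp
    moreover have "\<bar>g k \<omega>\<bar> \<le> 2 * B * M\<^sub>2" unfolding g_def
      by (rule order_trans[OF Cauchy_Schwarz_ineq2 mult_mono])
        (use \<phi>h_le[of "Suc k"] norm_err_le[OF k] nonneg in \<open>auto simp: err\<close>)
    ultimately show ?case
      using err_square_step_le[OF k] energy_step[of k] drift[OF k] windowed_excitation[OF k]
      unfolding err lag innovation_def coupling_def
      unfolding X_def t_def g_def h_def c_def x_def \<beta>_def by blast
  qed
  have d: "random_variable borel (d i)" if "1 \<le> i" for i
    using indep that by (simp add: indep_vars_def)
  have F_meas [measurable]: "F \<in> borel_measurable borel"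
    by (intro borel_measurable_continuous_onI continuous_at_imp_continuous_on ballI DERIV_isCont[OF P.F(3)])
  have past: "f \<in> borel_measurable M" if "f \<in> borel_measurable (generated d {1..k})"
    for k and f :: "'a \<Rightarrow> 'b::topological_space"
    by (rule measurable_from_subalg[OF _ that]) (auto simp: subalgebra_def intro!: sets_generated_subset d)
  have gh_past: "g k \<in> borel_measurable (generated d {1..k})" for k
    unfolding g_def e_def using meas by measurable
  have [measurable]: "X k \<in> borel_measurable M" "g k \<in> borel_measurable M" "h k \<in> borel_measurable M"
    "t k \<in> borel_measurable M" for k
    unfolding X_def g_def h_def t_def e_def using past[OF meas(1)] past[OF meas(2)] by measurable
  have s_meas [measurable]: "s (Suc k) \<in> borel_measurable M" for k
    using d[of "Suc k"] by (simp add: s cong: measurable_cong) measurable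
  have int: "integrable M (X k)" "integrable M (t k)" "integrable M (g k)" if "k \<ge> 1" for k
  proof -
    show "integrable M (X k)"
      by (rule integrable_const_bound[of _ "(2 * B)\<^sup>2"]) (use AE_path[OF that] in \<open>auto simp: X_def\<close>)
    show "integrable M (t k)"
      by (rule integrable_const_bound[of _ "(M\<^sub>1 * (2 * B))\<^sup>2"]) (use AE_path[OF that] in \<open>auto simp: t_def\<close>)
    show "integrable M (g k)"
      by (rule integrable_const_bound[of _ "2 * B * M\<^sub>2"]) (use AE_path[OF that] in auto)
  qed
  have int_gh: "integrable M (\<lambda>\<omega>. g k \<omega> * h k \<omega>)" if "k \<ge> 1" for k
  proof (rule Bochner_Integration.integrable_bound[OF int(3)[OF that]])
    show "AE \<omega> in M. norm (g k \<omega> * h k \<omega>) \<le> norm (g k \<omega>)"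
      using P.F(1,2) by (auto simp: h_def abs_mult intro!: mult_left_le)
  qed measurable
  have int_gs: "integrable M (\<lambda>\<omega>. g k \<omega> * s (Suc k) \<omega>)" if "k \<ge> 1" for k
  proof (rule Bochner_Integration.integrable_bound[OF int(3)[OF that]])
    show "AE \<omega> in M. norm (g k \<omega> * s (Suc k) \<omega>) \<le> norm (g k \<omega>)"
      by (intro AE_I2) (simp add: s abs_mult indicator_def)
  qed measurable
  \<comment> \<open>The observation is the indicator of
    \<open>d (Suc k) \<le> C - y (Suc k)\<close>, independent of the past-measurable
    \<open>g k\<close>; its mean is the value of \<open>F\<close> at that threshold.\<close>
  have innovation: "expectation (\<lambda>\<omega>. g k \<omega> * (h k \<omega> - s (Suc k) \<omega>))
      = expectation (\<lambda>\<omega>. g k \<omega> * (h k \<omega> - F (C - y (int (Suc k)))))" if k: "k \<ge> 1" for k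
  proof -
    have "expectation (\<lambda>\<omega>. g k \<omega> * s (Suc k) \<omega>)
        = expectation (\<lambda>\<omega>. g k \<omega> * indicator {..C - y (int (Suc k))} (d (Suc k) \<omega>))"
      by (intro Bochner_Integration.integral_cong) (simp_all add: s)
    also have "\<dots> = expectation (g k) * F (C - y (int (Suc k)))"
      by (subst expectation_past_mult_indicator[OF indep gh_past int(3)[OF k]]) (simp add: cdf)
    finally show ?thesis
      using int(3)[OF k] int_gh[OF k] int_gs[OF k] by (simp add: right_diff_distrib)
  qed
  \<comment> \<open>\<open>V\<close> and \<open>T\<close> are set to 0 at the start, because the
    path bounds begin at index 1 while the recursion lemma asks for bounds everywhere.
    \<open>T\<close> is shifted so that \<open>T (Suc k)\<close> is the expectation of
    \<open>t k\<close>.\<close>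
  define V where "V k = (if k = 0 then 0 else expectation (X k))" for k
  define T where "T k = (if k \<le> 1 then 0 else expectation (t (k - 1)))" for k
  define R where "R = max ((2 * B)\<^sup>2) ((M\<^sub>1 * (2 * B))\<^sup>2)"
  have "V \<longlonglongrightarrow> 0"
  \<comment> \<open>The gain is \<open>2 * \<gamma>\<close>, from expanding the square; the
    second-order term equals \<open>2 * \<gamma> / Suc k\<close> times the second summand of
    \<open>r\<close>.\<close>
  proof (rule windowed_excitation_tendsto_0[where K = 1 and D = R and r' = x
        and r = "\<lambda>k. c k + \<gamma> * M\<^sub>2\<^sup>2 / 2 / real (Suc k)"])
    show "N > 0" "2 * \<gamma> > 0" "f\<^sub>m \<ge> 0" "\<beta> < f\<^sub>m * \<delta>" using N \<gamma> P.f(2) gap by (auto simp: \<beta>_def)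
    show V0: "0 \<le> V k" for k by (simp add: V_def X_def)
    show "V k \<le> R" for k
    proof (cases "k = 0")
      case False
      then have "expectation (X k) \<le> (2 * B)\<^sup>2"
        using AE_path[of k] int(1)[of k] by (intro integral_le_const) auto
      then show ?thesis using False by (simp add: V_def R_def)
    qed (simp add: V_def R_def le_max_iff_disj)
    show "\<bar>T k\<bar> \<le> R" for k
    proof (cases "k \<le> 1")
      case False
      then have "expectation (t (k - 1)) \<le> (M\<^sub>1 * (2 * B))\<^sup>2"
        using AE_path[of "k - 1"] int(2)[of "k - 1"] by (intro integral_le_const) auto
      moreover have "0 \<le> expectation (t (k - 1))" by (simp add: t_def)
      ultimately show ?thesis using False by (simp add: T_def R_def)
    qed (simp add: T_def R_def le_max_iff_disj)
  next
    fix k :: nat assume k: "1 \<le> k"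
    then have V: "V k = expectation (X k)" "V (Suc k) = expectation (X (Suc k))" and T: "T (Suc (k + i)) = expectation (t (k + i))" for i
      by (simp_all add: V_def T_def)
    have int_q: "integrable M (\<lambda>\<omega>. g k \<omega> * (h k \<omega> - s (Suc k) \<omega>))" "integrable M (\<lambda>\<omega>. g k \<omega> * (h k \<omega> - F (C - y (int (Suc k)))))"
      using int(3)[OF k] int_gh[OF k] int_gs[OF k] by (simp_all add: right_diff_distrib)
    have "expectation (\<lambda>\<omega>. g k \<omega> * (h k \<omega> - F (C - y (int (Suc k)))))
        \<le> expectation (\<lambda>\<omega>. - f\<^sub>m * t k \<omega> + \<beta> * X k \<omega> + c k)"
      using AE_path[OF k] int_q int[OF k] by (intro integral_mono_AE) auto
    also have "\<dots> = - f\<^sub>m * T (Suc k) + \<beta> * V k + c k"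
      using int[OF k] T[of 0] V by (simp add: prob_space)
    finally have drift: "expectation (\<lambda>\<omega>. g k \<omega> * (h k \<omega> - s (Suc k) \<omega>)) \<le> - f\<^sub>m * T (Suc k) + \<beta> * V k + c k"
      using innovation[OF k] by simp
    have "V (Suc k) \<le> expectation (\<lambda>\<omega>. X k \<omega> + 2 * \<gamma> / real (Suc k) * (g k \<omega> * (h k \<omega> - s (Suc k) \<omega>)) + (\<gamma> * M\<^sub>2 / real (Suc k))\<^sup>2)"
      unfolding V using AE_path[OF k] int_q int[OF k] int(1)[of "Suc k"] by (intro integral_mono_AE) auto
    also have "\<dots> = V k + 2 * \<gamma> / real (Suc k) * expectation (\<lambda>\<omega>. g k \<omega> * (h k \<omega> - s (Suc k) \<omega>)) + (\<gamma> * M\<^sub>2 / real (Suc k))\<^sup>2"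
      unfolding V using int_q int[OF k] by (simp add: prob_space del: of_nat_Suc)
    also have "\<dots> \<le> V k + 2 * \<gamma> / real (Suc k) * (- f\<^sub>m * T (Suc k) + \<beta> * V k + c k) + (\<gamma> * M\<^sub>2 / real (Suc k))\<^sup>2"
      using drift \<gamma> by (intro add_mono mult_left_mono) auto
    also have "\<dots> = V k - 2 * \<gamma> / real (Suc k) * (f\<^sub>m * T (Suc k) - \<beta> * V k - (c k + \<gamma> * M\<^sub>2\<^sup>2 / 2 / real (Suc k)))"
      by (simp add: power2_eq_square algebra_simps add_divide_distrib diff_divide_distrib del: of_nat_Suc)
    finally show "V (Suc k) \<le> V k - 2 * \<gamma> / real (Suc k) * (f\<^sub>m * T (Suc k) - \<beta> * V k - (c k + \<gamma> * M\<^sub>2\<^sup>2 / 2 / real (Suc k)))" .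
    have "real N * \<delta> * V k - x k = expectation (\<lambda>\<omega>. real N * \<delta> * X k \<omega> - x k)"
      unfolding V using int[OF k] by (simp add: prob_space)
    also have "\<dots> \<le> expectation (\<lambda>\<omega>. \<Sum>i<N. t (k + i) \<omega>)"
      using AE_path[OF k] int[OF k] int(2)[of "k + i" for i] k by (intro integral_mono_AE) auto
    also have "\<dots> = (\<Sum>i<N. T (Suc (k + i)))"
      unfolding T using int(2)[of "k + i" for i] k by (intro Bochner_Integration.integral_sum) auto
    finally show "real N * \<delta> * V k - x k \<le> (\<Sum>i<N. T (Suc (k + i)))" .
    have "\<bar>V (Suc k) - V k\<bar> = \<bar>expectation (\<lambda>\<omega>. X (Suc k) \<omega> - X k \<omega>)\<bar>"
      unfolding V using int(1)[OF k] int(1)[of "Suc k"] by simp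
    also have "\<dots> \<le> expectation (\<lambda>\<omega>. \<bar>X (Suc k) \<omega> - X k \<omega>\<bar>)"
      by (rule integral_abs_bound)
    also have "\<dots> \<le> \<gamma> * M\<^sub>2 * (4 * B) / real (Suc k)"
      using AE_path[OF k] int(1)[OF k] int(1)[of "Suc k"] by (intro integral_le_const) auto
    finally show "\<bar>V (Suc k) - V k\<bar> \<le> \<gamma> * M\<^sub>2 * (4 * B) / real (Suc k)" .
  next
    have null: "(\<lambda>k. q / real (Suc k)) \<longlonglongrightarrow> 0" for q :: real
      using LIMSEQ_Suc[OF lim_const_over_n[of q]] by simp
    have "l \<longlonglongrightarrow> 0"
      unfolding l_def using P.\<rho> D0 \<gamma> nonneg by (intro transient_tendsto_0) auto
    then have "c \<longlonglongrightarrow> 0" unfolding c_def by (rule tendsto_mult_right_zero)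
    from tendsto_add[OF this null[of "\<gamma> * M\<^sub>2\<^sup>2 / 2"]]
    show "(\<lambda>k. c k + \<gamma> * M\<^sub>2\<^sup>2 / 2 / real (Suc k)) \<longlonglongrightarrow> 0"
      by (simp only: add_0_right)
    show "x \<longlonglongrightarrow> 0"
      unfolding x_def by (intro tendsto_mult_right_zero null)
  qed
  moreover have "eventually (\<lambda>k. V k = expectation (\<lambda>\<omega>. (\<theta>h k \<omega> - \<theta>) \<bullet> (\<theta>h k \<omega> - \<theta>))) sequentially"
    using eventually_gt_at_top[of 0] by eventually_elim (simp add: V_def X_def[abs_def] e_def)
  ultimately show ?thesis by (rule Lim_transform_eventually)
qed

text \<open>Input excitation on the \<open>m\<close> times from \<open>k + p\<close> on bounds the
  least eigenvalue there from below; the assumed transfer passes this to the regressors on the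
  \<open>p + m\<close> times from \<open>k\<close> on, and the Rayleigh bound turns it into a sum of
  squares.\<close>

lemma excitation_transfer:
  fixes \<phi> U :: "int \<Rightarrow> real^'n"
  assumes m: "m > 0" and c\<^sub>0: "c\<^sub>0 \<ge> 0" and k: "k \<ge> 1"
    and input: "\<And>k. k \<ge> 1 \<Longrightarrow> loewner_le (\<delta>\<^sub>1 *\<^sub>R mat 1) ((1 / real m) *\<^sub>R (\<Sum>i = k..k + int m - 1. outer (U i) (U i)))"
    and transfer: "lambda_min (\<Sum>i = k..k + int p + int m - 1. outer (\<phi> i) (\<phi> i))
      \<ge> c\<^sub>0 * lambda_min ((1 / real m) *\<^sub>R (\<Sum>i = k + int p..k + int p + int m - 1. outer (U i) (U i)))"
  shows "c\<^sub>0 * \<delta>\<^sub>1 * (v \<bullet> v) \<le> (\<Sum>i<p + m. (\<phi> (k + int i) \<bullet> v)\<^sup>2)"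
proof -
  have "\<delta>\<^sub>1 \<le> lambda_min ((1 / real m) *\<^sub>R (\<Sum>i = k + int p..k + int p + int m - 1. outer (U i) (U i)))"
    by (rule le_lambda_min) (use input[of "k + int p"] k in \<open>simp_all add: transpose_scalar transpose_sum_outer\<close>)
  then have "c\<^sub>0 * \<delta>\<^sub>1 \<le> lambda_min (\<Sum>i = k..k + int p + int m - 1. outer (\<phi> i) (\<phi> i))"
    using transfer mult_left_mono[OF _ c\<^sub>0] by (meson order_trans)
  then have "c\<^sub>0 * \<delta>\<^sub>1 * (v \<bullet> v) \<le> lambda_min (\<Sum>i = k..k + int p + int m - 1. outer (\<phi> i) (\<phi> i)) * (v \<bullet> v)"
    by (intro mult_right_mono) auto
  also have "\<dots> \<le> (\<Sum>i = k..k + int p + int m - 1. (\<phi> i \<bullet> v)\<^sup>2)"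
    using lambda_min_le_inner[OF transpose_sum_outer, of \<phi> _ v] by (simp add: inner_sum_outer)
  also have "\<dots> = (\<Sum>i<p + m. (\<phi> (k + int i) \<bullet> v)\<^sup>2)"
    by (rule sum.reindex_bij_witness[of _ "\<lambda>i. k + int i" "\<lambda>j. nat (j - k)"]) auto
  finally show ?thesis .
qed

theorem theorem1:
  fixes P :: "'w measure"
    and p q m N :: nat
    and a b :: "nat \<Rightarrow> real"
    and y u :: "int \<Rightarrow> real"
    and d z s :: "nat \<Rightarrow> 'w \<Rightarrow> real"
    and F f :: "real \<Rightarrow> real"
    and C h \<gamma> \<epsilon> h\<^sub>1 M M\<^sub>1 M\<^sub>2 f\<^sub>M f\<^sub>m \<delta> \<delta>\<^sub>1 c\<^sub>0 B\<^sub>\<Theta> :: real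
    and \<theta> \<theta>\<^sub>0 :: "real^('p::finite + 'q::finite)"
    and \<Theta> :: "(real^('p + 'q)) set"
    and \<phi> :: "int \<Rightarrow> real^('p + 'q)"
    and \<theta>h :: "nat \<Rightarrow> 'w \<Rightarrow> real^('p + 'q)"
    and \<phi>h :: "int \<Rightarrow> 'w \<Rightarrow> real^('p + 'q)"
    and yh :: "int \<Rightarrow> 'w \<Rightarrow> real"
    and y\<^sub>0 :: "int \<Rightarrow> real"
    and A :: "real^'p^'p"
    and J :: "real set"
  assumes "prob_space P"
    (* system *)
    and "p = CARD('p)" and "q = CARD('q)"
    and "a p \<noteq> 0"
    and "\<nexists>x. ar_fun p a x = 0 \<and> input_fun q b x = 0"
    and "\<And>k. k \<ge> 1 \<Longrightarrow> y k = (\<Sum>i = 1..p. a i * y (k - int i)) + (\<Sum>j = 1..q. b j * u (k - int j + 1))"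
    and "\<And>k \<omega>. k \<ge> 1 \<Longrightarrow> \<omega> \<in> space P \<Longrightarrow> z k \<omega> = y (int k) + d k \<omega>"
    and "\<And>k \<omega>. k \<ge> 1 \<Longrightarrow> \<omega> \<in> space P \<Longrightarrow> s k \<omega> = (if z k \<omega> \<le> C then 1 else 0)"
    and "\<theta> = stack a b"
    and "\<And>k. \<phi> k = regressor y u k"
    (* parameter set *)
    and "0 < h" and "h < 1"
    and "convex \<Theta>" and "compact \<Theta>" and "\<Theta> \<subseteq> stable_params h" and "\<theta> \<in> \<Theta>"
    and "B\<^sub>\<Theta> = (SUP v\<in>\<Theta>. norm v)"
    (* noise *)
    and "prob_space.indep_vars P (\<lambda>_. borel) d {1..}"
    and "\<And>k. k \<ge> 1 \<Longrightarrow> cdf (distr P borel (d k)) = F"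
    and "\<And>k. k \<ge> 1 \<Longrightarrow> integrable P (d k)"
    and "\<And>k. k \<ge> 1 \<Longrightarrow> prob_space.expectation P (d k) = 0"
    and "\<And>x. (F has_real_derivative f x) (at x)"
    and "continuous_on UNIV f" and "\<And>x. f x \<noteq> 0"
    (* input *)
    and "bounded (u ` {1..})"
    and "\<delta>\<^sub>1 > 0" and "m > 0"
    and "\<And>k. k \<ge> 1 \<Longrightarrow> loewner_le (\<delta>\<^sub>1 *\<^sub>R mat 1)
           ((1 / real m) *\<^sub>R (\<Sum>i = k..k + int m - 1.
              outer (input_vector u i :: real^('p + 'q)) (input_vector u i)))"
    (* algorithm *)
    and "\<gamma> > 0"
    and "\<And>\<omega>. \<omega> \<in> space P \<Longrightarrow> \<theta>h 0 \<omega> = \<theta>\<^sub>0"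
    and "\<And>k \<omega>. k \<le> 0 \<Longrightarrow> \<omega> \<in> space P \<Longrightarrow> yh k \<omega> = y\<^sub>0 k"
    and "\<And>k \<omega>. \<omega> \<in> space P \<Longrightarrow> \<phi>h k \<omega> = regressor (\<lambda>t. yh t \<omega>) u k"
    and "\<And>k \<omega>. k \<ge> 1 \<Longrightarrow> \<omega> \<in> space P \<Longrightarrow> yh (int k) \<omega> = \<phi>h (int k) \<omega> \<bullet> \<theta>h k \<omega>"
    and "\<And>k \<omega>. k \<ge> 1 \<Longrightarrow> \<omega> \<in> space P \<Longrightarrow>
           \<theta>h k \<omega> = closest_point \<Theta>
             (\<theta>h (k - 1) \<omega> + (\<gamma> / real k * (F (C - \<phi>h (int k) \<omega> \<bullet> \<theta>h (k - 1) \<omega>) - s k \<omega>))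
                *\<^sub>R \<phi>h (int k) \<omega>)"
    (* constants *)
    and "A = companion a"
    and "\<epsilon> > 0" and "h\<^sub>1 = spectral_radius A + \<epsilon> * onorm ((*v) A)" and "h\<^sub>1 < 1"
    and "M = sqrt (real p) * (1 + 2 / \<epsilon>) ^ (p - 1)"
    and "M\<^sub>1 > 0" and "\<And>k. k \<ge> 1 \<Longrightarrow> norm (\<phi> k) \<le> M\<^sub>1"
    and "M\<^sub>2 > 0" and "AE \<omega> in P. \<forall>k\<ge>1. norm (\<phi>h k \<omega>) \<le> M\<^sub>2"
    and "J = {C - B\<^sub>\<Theta> * M\<^sub>2..C + B\<^sub>\<Theta> * M\<^sub>2} \<union> {C - B\<^sub>\<Theta> * M\<^sub>1..C + B\<^sub>\<Theta> * M\<^sub>1}"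
    and "f\<^sub>M \<in> f ` J" and "\<And>x. x \<in> J \<Longrightarrow> f x \<le> f\<^sub>M"
    and "f\<^sub>m \<in> f ` J" and "\<And>x. x \<in> J \<Longrightarrow> f\<^sub>m \<le> f x"
    and "N = p + m"
    and "c\<^sub>0 > 0"
    and "\<And>k. k \<ge> 1 \<Longrightarrow>
           lambda_min (\<Sum>i = k..k + int p + int m - 1. outer (\<phi> i) (\<phi> i))
           \<ge> c\<^sub>0 * lambda_min ((1 / real m) *\<^sub>R (\<Sum>i = k + int p..k + int p + int m - 1.
                outer (input_vector u i :: real^('p + 'q)) (input_vector u i)))"
    and "\<delta> = c\<^sub>0 * \<delta>\<^sub>1 / real N"
    (* convergence condition *)
    and "f\<^sub>m * \<delta> - f\<^sub>M * sqrt (g_bound p h) * M\<^sub>2 * M / (1 - h\<^sub>1) * (M\<^sub>2 + 2 * M\<^sub>1) > 0"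
  shows "(\<lambda>k. prob_space.expectation P (\<lambda>\<omega>. (\<theta>h k \<omega> - \<theta>) \<bullet> (\<theta>h k \<omega> - \<theta>))) \<longlonglongrightarrow> 0"
proof -
  note [simp] = assms(2,3)
  interpret prob_space P by fact
  have d: "random_variable borel (d k)" if "k \<ge> 1" for k
    using assms(18) that by (simp add: indep_vars_def)
  interpret D: real_distribution "distr P borel (d 1)" using d by simp
  have F_cdf: "F = cdf (distr P borel (d 1))" using assms(19)[of 1] by simp
  have F01: "0 \<le> F x" "F x \<le> 1" for x
    unfolding F_cdf by (rule D.cdf_nonneg, rule D.cdf_bounded_prob)
  have "mono F" unfolding F_cdf by (intro monoI D.cdf_nondecreasing)
  then have f_nonneg: "0 \<le> f x" for x
    by (rule mono_imp_derivative_nonneg[OF _ assms(22)])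
  have F_meas: "F \<in> borel_measurable borel"
    by (intro borel_measurable_continuous_onI continuous_at_imp_continuous_on ballI DERIV_isCont[OF assms(22)])
  have \<Theta>_closed: "closed \<Theta>" using assms(14) by (rule compact_imp_closed)
  have norm_le: "norm v \<le> B\<^sub>\<Theta>" if "v \<in> \<Theta>" for v
  proof -
    have "bdd_above (norm ` \<Theta>)"
      using compact_imp_bounded[OF assms(14)] by (auto simp: bounded_iff bdd_above_def)
    then show ?thesis unfolding assms(17) by (rule cSUP_upper[OF that])
  qed
  have B: "0 \<le> B\<^sub>\<Theta>" by (rule order_trans[OF norm_ge_zero norm_le[OF assms(16)]])
  have f_range: "f\<^sub>m \<le> f x \<and> f x \<le> f\<^sub>M" if "\<bar>x - C\<bar> \<le> B\<^sub>\<Theta> * max M\<^sub>1 M\<^sub>2" for x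
  proof -
    \<comment> \<open>Both intervals of \<open>J\<close> are centred at \<open>C\<close>, so their
      union is the one of larger radius.\<close>
    have "x \<in> J" using that by (auto simp: assms(44) max_def abs_le_iff split: if_splits)
    then show ?thesis using assms(46,48) by blast
  qed
  have fm: "0 \<le> f\<^sub>m" using assms(47) f_nonneg by auto
  have \<phi>_eq: "\<phi> = regressor y u" using assms(10) by (rule ext)
  have y_eq: "y (int k) = \<phi> (int k) \<bullet> \<theta>" if "k \<ge> 1" for k :: nat
    using assms(6)[of "int k"] that
    by (simp add: \<phi>_eq assms(9) regressor_def inner_stack mult.commute)
  have pow: "norm (((*v) (companion a :: real^'p^'p) ^^ n) x) \<le> M * h\<^sub>1 ^ n * norm x" and h1: "0 \<le> h\<^sub>1" and M: "0 \<le> M" for n x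
  proof -
    note bound = norm_funpow_companion_le[OF assms(36), where a = a and 'p = 'p, folded assms(35)]
    show h1: "0 \<le> h\<^sub>1"
      unfolding assms(37) using bound(2) assms(36) onorm_pos_le[OF matrix_vector_mul_bounded_linear, of A] by simp
    \<comment> \<open>Since \<open>sqrt (real p)\<close> is at least 1, \<open>M\<close> dominates
      the constant of the companion bound.\<close>
    have "1 \<le> sqrt (real p)" by (simp add: Suc_le_eq)
    then have "1 * (1 + 2 / \<epsilon>) ^ (p - 1) \<le> M"
      unfolding assms(39) using assms(36) by (intro mult_right_mono) auto
    then have KM: "(1 + 2 / \<epsilon>) ^ (p - 1) \<le> M" by simp
    show "0 \<le> M" using assms(36) by (intro order_trans[OF _ KM]) auto
    have "norm (((*v) A ^^ n) x) \<le> (1 + 2 / \<epsilon>) ^ (p - 1) * h\<^sub>1 ^ n * norm x"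
      using bound(1)[of n x] by (simp add: assms(37))
    also have "\<dots> \<le> M * h\<^sub>1 ^ n * norm x"
      using KM h1 by (intro mult_right_mono) auto
    finally show "norm (((*v) (companion a :: real^'p^'p) ^^ n) x) \<le> M * h\<^sub>1 ^ n * norm x"
      by (simp add: assms(35))
  qed
  have excitation: "real N * \<delta> * (v \<bullet> v) \<le> (\<Sum>i<N. (\<phi> (int (k + i)) \<bullet> v)\<^sup>2)" if "k \<ge> 1" for k v
  proof -
    have "c\<^sub>0 * \<delta>\<^sub>1 * (v \<bullet> v) \<le> (\<Sum>i<p + m. (\<phi> (int k + int i) \<bullet> v)\<^sup>2)"
      by (rule excitation_transfer[OF assms(27) _ _ assms(28) assms(51)]) (use assms(50) that in auto)
    moreover have "real N * \<delta> = c\<^sub>0 * \<delta>\<^sub>1" using assms(27) by (simp add: assms(52) assms(49))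
    ultimately show ?thesis by (simp add: assms(49))
  qed
  have s_cases: "s k \<omega> = 0 \<or> s k \<omega> = 1" if "k \<ge> 1" "\<omega> \<in> space P" for k \<omega>
    using assms(8)[OF that] by auto
  show ?thesis
  \<comment> \<open>The initial deviation is built from fixed initial values, hence the same for
    every outcome.\<close>
  proof (rule mean_square_convergence[where D = "norm (window (\<lambda>t. y\<^sub>0 t - y t) 0 :: real^'p)"])
    show "AE \<omega> in P. identification_path a b y u (\<lambda>t. yh t \<omega>) \<theta> \<Theta> \<phi> (\<lambda>k. \<phi>h k \<omega>) (\<lambda>k. \<theta>h k \<omega>)
      (\<lambda>k. s k \<omega>) F f \<gamma> C B\<^sub>\<Theta> M\<^sub>1 M\<^sub>2 f\<^sub>m f\<^sub>M (sqrt (g_bound p h)) M h\<^sub>1 \<delta> N"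
      using assms(43) AE_space
    proof eventually_elim
      case (elim \<omega>)
      have update: "\<theta>h k \<omega> = closest_point \<Theta> (\<theta>h (k - 1) \<omega> +
          (\<gamma> / real k * (F (C - \<phi>h (int k) \<omega> \<bullet> \<theta>h (k - 1) \<omega>) - s k \<omega>)) *\<^sub>R \<phi>h (int k) \<omega>)"
        if "k \<ge> 1" for k by (rule assms(34)[OF that elim(2)])
      have yh_eq: "yh (int k) \<omega> = \<phi>h (int k) \<omega> \<bullet> \<theta>h k \<omega>" if "k \<ge> 1" for k :: nat
        by (rule assms(33)[OF that elim(2)])
      have \<phi>_le: "norm (\<phi> (int k)) \<le> M\<^sub>1" and \<phi>h_le: "norm (\<phi>h (int k) \<omega>) \<le> M\<^sub>2" if "k \<ge> 1" for k :: nat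
        using assms(41)[of "int k"] elim(1) that by auto
      have \<gamma>: "0 \<le> \<gamma>" using assms(29) by simp
      show ?case
      proof
        show "(\<lambda>k. \<phi>h k \<omega>) = regressor (\<lambda>t. yh t \<omega>) u"
          by (intro ext assms(32)[OF elim(2)])
        show "sqrt (\<Sum>r\<in>UNIV. (v $ Inl r)\<^sup>2) \<le> sqrt (g_bound p h)" if "v \<in> \<Theta>" for v
          using stable_params_sum_squares_le[of v h] that assms(15,11) by auto
        show "0 \<le> s k \<omega>" "s k \<omega> \<le> 1" if "k \<ge> 1" for k
          using s_cases[OF that elim(2)] by auto
      qed (fact assms(9,13,16,22,38) \<phi>_eq y_eq yh_eq update \<Theta>_closed norm_le \<gamma> F01 f_range fm
          \<phi>_le \<phi>h_le h1 M pow excitation)+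
    qed
    show "norm (window (\<lambda>t. yh t \<omega> - y t) 0 :: real^'p) = norm (window (\<lambda>t. y\<^sub>0 t - y t) 0 :: real^'p)"
      if "\<omega> \<in> space P" for \<omega>
    proof -
      have "yh (1 - int (coord r)) \<omega> = y\<^sub>0 (1 - int (coord r))" for r :: 'p
        using coord_le[of r] that by (intro assms(31)) auto
      then show ?thesis by (simp add: window_def)
    qed
    show "s (Suc k) \<omega> = indicator {..C - y (int (Suc k))} (d (Suc k) \<omega>)" if "\<omega> \<in> space P" for k \<omega>
      using assms(7)[of "Suc k" \<omega>] assms(8)[of "Suc k" \<omega>] that by (simp add: indicator_def algebra_simps)
    have s_meas: "s j \<in> borel_measurable (generated d {1..k})" if "1 \<le> j" "j \<le> k" for j k
    proof -
      have [measurable]: "d j \<in> borel_measurable (generated d {1..k})"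
        by (rule measurable_generated) (use that in simp)
      have "s j \<omega> = (if y (int j) + d j \<omega> \<le> C then 1 else 0)" if "\<omega> \<in> space (generated d {1..k})" for \<omega>
        using assms(7)[of j \<omega>] assms(8)[of j \<omega>] \<open>1 \<le> j\<close> that by simp
      then show ?thesis by (subst measurable_cong) measurable
    qed
    \<comment> \<open>The history up to \<open>k\<close> serves as the measure and
      \<open>n = k\<close>, so measurability is asked of the first \<open>k\<close> observations
      only.\<close>
    show "\<theta>h k \<in> borel_measurable (generated d {1..k})" "\<phi>h (int (Suc k)) \<in> borel_measurable (generated d {1..k})" for k
      using measurable_estimates[of "generated d {1..k}" \<theta>h \<theta>\<^sub>0 yh y\<^sub>0 \<phi>h u \<Theta> \<gamma> F C s k k]
        assms(13,16,30,31,32,33,34) \<Theta>_closed F_meas s_meas by auto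
    show "N > 0" using assms(27,49) by simp
    show "f\<^sub>M * sqrt (g_bound p h) * M\<^sub>2 * M / (1 - h\<^sub>1) * (M\<^sub>2 + 2 * M\<^sub>1) < f\<^sub>m * \<delta>"
      using assms(53) by linarith
  qed (fact assms(18,19,29))+
qed

end
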